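(* Let $\mathcal{T}$ be a closed PDL-tableau. Then for every node $t$ of $\mathcal{T}$, the sequent $\Lambda(t)$ labelling $t$ is unsatisfiable (where marks on loaded programs are ignored semantically).
   Context: PDL syntax: $\phi ::= \bot \mid p \mid \lnot\phi \mid \phi\land\phi \mid [\alpha]\phi$, $\alpha ::= a \mid \tau? \mid \alpha\cup\beta \mid \alpha;\beta \mid \alpha^\ast$ ($a$ atomic programs), with standard Kripke semantics. For a list $\bar\delta=\delta_1\cdots\delta_n$ of programs, $\Box(\bar\delta,\phi)=[\delta_1]\cdots[\delta_n]\phi$ ($=\phi$ if $\bar\delta=\varepsilon$); juxtaposition is concatenation. Unfolding boxes: $\mathit{Tests}(a)=\emptyset$, $\mathit{Tests}(\tau?)=\{\tau\}$, $\mathit{Tests}(\alpha\cup\beta)=\mathit{Tests}(\alpha;\beta)=\mathit{Tests}(\alpha)\cup\mathit{Tests}(\beta)$, $\mathit{Tests}(\alpha^\ast)=\mathit{Tests}(\alpha)$. For a set $\ell$ of formulas: $P^\ell(a)=\{a\}$; $P^\ell(\tau?)=\{\varepsilon\}$ if $\tau\in\ell$, else $\emptyset$; $P^\ell(\beta\cup\gamma)=P^\ell(\beta)\cup P^\ell(\gamma)$; $P^\ell(\beta;\gamma)=\{\bar\beta\gamma\mid\bar\beta\in P^\ell(\beta)\setminus\{\varepsilon\}\}\cup\{\bar\gamma\mid\bar\gamma\in P^\ell(\gamma),\varepsilon\in P^\ell(\beta)\}$; $P^\ell(\beta^\ast)=\{\varepsilon\}\cup\{\bar\beta\beta^\ast\mid\bar\beta\in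 P^\ell(\beta)\setminus\{\varepsilon\}\}$. $F^\ell(\alpha)=\{\lnot\tau\mid\tau\in\mathit{Tests}(\alpha),\tau\notin\ell\}$, $X^\ell_{\alpha,\psi}=F^\ell(\alpha)\cup\{\Box(\bar\alpha,\psi)\mid\bar\alpha\in P^\ell(\alpha)\}$, $\mathsf{unfold}_\Box(\alpha,\psi)=\{X^\ell_{\alpha,\psi}\mid\ell\subseteq\mathit{Tests}(\alpha)\}$. Unfolding diamonds: $H_a=\{(\emptyset,a)\}$, $H_{\tau?}=\{(\{\tau\},\varepsilon)\}$, $H_{\alpha\cup\beta}=H_\alpha\cup H_\beta$, $H_{\alpha;\beta}=\{(X,\bar\delta\beta)\mid(X,\bar\delta)\in H_\alpha,\bar\delta\neq\varepsilon\}\cup\{(X\cup Y,\bar\delta)\mid(X,\varepsilon)\in H_\alpha,(Y,\bar\delta)\in H_\beta\}$, $H_{\alpha^\ast}=\{(\emptyset,\varepsilon)\}\cup\{(X,\bar\delta\alpha^\ast)\mid(X,\bar\delta)\in H_\alpha,\bar\delta\neq\varepsilon\}$; $\mathsf{unfold}_\Diamond(\alpha,\psi)=\{X\cup\{\lnot\Box(\bar\delta,\psi)\}\mid(X,\bar\delta)\in H_\alpha\}$. Loading: each program $\alpha$ has a marked copy $\underline\alpha$ (semantically identical). A loaded formula has the form $\lnot[\underline{\alpha_1}]\cdots[\underline{\alpha_n}]\phi$, $n\ge1$, $\phi$ an unmarked PDL formula; $\xi$ ranges over PDL formulas and expressions $[\underline{\alpha_1}]\cdots[\underline{\alpha_k}]\phi$,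 $k\ge1$. $\underline\Box(\bar\delta,\xi)=[\underline{\delta_1}]\cdots[\underline{\delta_n}]\xi$, $\underline{\mathsf{unfold}}_\Diamond(\alpha,\xi)=\{X\cup\{\lnot\underline\Box(\bar\delta,\xi)\}\mid(X,\bar\delta)\in H_\alpha\}$. A sequent (finite set of possibly loaded formulas) is loaded if it contains a loaded formula, else free; it is basic if all its formulas have the form $\bot,\lnot\bot,p,\lnot p,[a]\phi,\lnot[a]\phi$ ($a$ atomic). $\Delta_a=\{\phi\mid[a]\phi\in\Delta\}$. Rules (principal formula not in context $\Delta$): $(\lnot)$ $\Delta,\lnot\lnot\phi/\Delta,\phi$; $(\land)$ $\Delta,\phi\land\psi/\Delta,\phi,\psi$; $(\lnot\land)$ $\Delta,\lnot(\phi\land\psi)/\Delta,\lnot\phi\mid\Delta,\lnot\psi$; $(\Box)$ $\Delta,[\alpha]\phi/\{\Delta\cup\Gamma\mid\Gamma\in\mathsf{unfold}_\Box(\alpha,\phi)\}$, $\alpha$ non-atomic; $(\Diamond)$ $\Delta,\lnot[\alpha]\phi/\{\Delta\cup\Gamma\mid\Gamma\in\mathsf{unfold}_\Diamond(\alpha,\phi)\}$, $\alpha$ non-atomic; $(\underline\Diamond)$ $\Delta,\lnot[\underline\alpha]\xi/\{\Delta\cup\Gamma\mid\Gamma\in\underline{\mathsf{unfold}}_\Diamond(\alpha,\xi)\}$, $\alpha$ non-atomic; $(L+)$ $\Delta,\lnot[a][\alpha_1]\cdots[\alpha_n]\phi/\Delta,\lnot[\underline a][\underline{\alpha_1}]\cdots[\underline{\alpha_n}]\phi$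 with $\Delta$ free and basic, $n\ge0$ maximal; $(L-)$ $\Delta,\lnot[\underline{\alpha_1}]\cdots[\underline{\alpha_n}]\phi/\Delta,\lnot[\alpha_1]\cdots[\alpha_n]\phi$ with $\Delta$ basic, $n\ge1$; modal rule $(M)$ $\Delta,\lnot[\underline a]\xi/\Delta_a,\lnot\xi$ with $\Delta$ basic. $(L-)$ may not be applied to a node produced by $(L+)$. A tableau is a rooted tree labelled by sequents in which each interior node with its children is a rule instance. A repeat is a node whose label equals that of a proper ancestor (nearest such: its companion); it is a loaded-path repeat if all nodes from companion to it are loaded, a free repeat if it is free. A PDL-tableau is a tableau in which all loaded-path repeats and all free repeats are leaves. A node is closed if its label contains $\bot$ or some $\phi$ and $\lnot\phi$; a PDL-tableau is closed if every leaf is closed or a loaded-path repeat. *)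

theory Defs
  imports Main "HOL-Library.Sublist"
begin

datatype ('p, 'a) fml =
    Bot
  | Prop 'p
  | Neg "('p, 'a) fml"
  | Conj "('p, 'a) fml" "('p, 'a) fml"
  | Box "('p, 'a) prog" "('p, 'a) fml"
and ('p, 'a) prog =
    Atom 'a
  | Test "('p, 'a) fml"
  | Choice "('p, 'a) prog" "('p, 'a) prog"
  | Seq "('p, 'a) prog" "('p, 'a) prog"
  | Star "('p, 'a) prog"

text \<open>The set of states of a Kripke model is the whole of the type \<open>'w\<close>.\<close>

record ('w, 'p, 'a) kripke =
  rel :: "'a \<Rightarrow> ('w \<times> 'w) set"
  val :: "'p \<Rightarrow> 'w set"

primrec sat :: "('w, 'p, 'a) kripke \<Rightarrow> ('p, 'a) fml \<Rightarrow> 'w \<Rightarrow> bool"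
  and prog_rel :: "('w, 'p, 'a) kripke \<Rightarrow> ('p, 'a) prog \<Rightarrow> ('w \<times> 'w) set" where
  "sat M Bot = (\<lambda>w. False)"
| "sat M (Prop p) = (\<lambda>w. w \<in> val M p)"
| "sat M (Neg \<phi>) = (\<lambda>w. \<not> sat M \<phi> w)"
| "sat M (Conj \<phi> \<psi>) = (\<lambda>w. sat M \<phi> w \<and> sat M \<psi> w)"
| "sat M (Box \<alpha> \<phi>) = (\<lambda>w. \<forall>v. (w, v) \<in> prog_rel M \<alpha> \<longrightarrow> sat M \<phi> v)"
| "prog_rel M (Atom a) = rel M a"
| "prog_rel M (Test \<tau>) = {(w, w) |w. sat M \<tau> w}"
| "prog_rel M (Choice \<alpha> \<beta>) = prog_rel M \<alpha> \<union> prog_rel M \<beta>"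
| "prog_rel M (Seq \<alpha> \<beta>) = prog_rel M \<alpha> O prog_rel M \<beta>"
| "prog_rel M (Star \<alpha>) = (prog_rel M \<alpha>)\<^sup>*"

definition is_atomic :: "('p, 'a) prog \<Rightarrow> bool" where
  "is_atomic \<alpha> \<longleftrightarrow> (\<exists>a. \<alpha> = Atom a)"

definition boxes :: "('p, 'a) prog list \<Rightarrow> ('p, 'a) fml \<Rightarrow> ('p, 'a) fml" where
  "boxes \<delta>s \<phi> = foldr Box \<delta>s \<phi>"

subsection \<open>Unfolding boxes\<close>

fun Tests :: "('p, 'a) prog \<Rightarrow> ('p, 'a) fml set" where
  "Tests (Atom a) = {}"
| "Tests (Test \<tau>) = {\<tau>}"
| "Tests (Choice \<alpha> \<beta>) = Tests \<alpha> \<union> Tests \<beta>"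
| "Tests (Seq \<alpha> \<beta>) = Tests \<alpha> \<union> Tests \<beta>"
| "Tests (Star \<alpha>) = Tests \<alpha>"

fun Pset :: "('p, 'a) fml set \<Rightarrow> ('p, 'a) prog \<Rightarrow> ('p, 'a) prog list set" where
  "Pset l (Atom a) = {[Atom a]}"
| "Pset l (Test \<tau>) = (if \<tau> \<in> l then {[]} else {})"
| "Pset l (Choice \<beta> \<gamma>) = Pset l \<beta> \<union> Pset l \<gamma>"
| "Pset l (Seq \<beta> \<gamma>) =
     {\<beta>s @ [\<gamma>] |\<beta>s. \<beta>s \<in> Pset l \<beta> - {[]}} \<union> {\<gamma>s. \<gamma>s \<in> Pset l \<gamma> \<and> [] \<in> Pset l \<beta>}"
| "Pset l (Star \<beta>) = {[]} \<union> {\<beta>s @ [Star \<beta>] |\<beta>s. \<beta>s \<in> Pset l \<beta> - {[]}}"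

definition Fset :: "('p, 'a) fml set \<Rightarrow> ('p, 'a) prog \<Rightarrow> ('p, 'a) fml set" where
  "Fset l \<alpha> = {Neg \<tau> |\<tau>. \<tau> \<in> Tests \<alpha> \<and> \<tau> \<notin> l}"

definition Xset ::
  "('p, 'a) fml set \<Rightarrow> ('p, 'a) prog \<Rightarrow> ('p, 'a) fml \<Rightarrow> ('p, 'a) fml set" where
  "Xset l \<alpha> \<psi> = Fset l \<alpha> \<union> {boxes \<alpha>s \<psi> |\<alpha>s. \<alpha>s \<in> Pset l \<alpha>}"

definition unfold_box ::
  "('p, 'a) prog \<Rightarrow> ('p, 'a) fml \<Rightarrow> ('p, 'a) fml set set" where
  "unfold_box \<alpha> \<psi> = {Xset l \<alpha> \<psi> |l. l \<subseteq> Tests \<alpha>}"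

subsection \<open>Unfolding diamonds\<close>

fun Hset :: "('p, 'a) prog \<Rightarrow> (('p, 'a) fml set \<times> ('p, 'a) prog list) set" where
  "Hset (Atom a) = {({}, [Atom a])}"
| "Hset (Test \<tau>) = {({\<tau>}, [])}"
| "Hset (Choice \<alpha> \<beta>) = Hset \<alpha> \<union> Hset \<beta>"
| "Hset (Seq \<alpha> \<beta>) =
     {(Y, \<delta>s @ [\<beta>]) |Y \<delta>s. (Y, \<delta>s) \<in> Hset \<alpha> \<and> \<delta>s \<noteq> []} \<union>
     {(Y \<union> Z, \<delta>s) |Y Z \<delta>s. (Y, []) \<in> Hset \<alpha> \<and> (Z, \<delta>s) \<in> Hset \<beta>}"
| "Hset (Star \<alpha>) =
     {({}, [])} \<union> {(Y, \<delta>s @ [Star \<alpha>]) |Y \<delta>s. (Y, \<delta>s) \<in> Hset \<alpha> \<and> \<delta>s \<noteq> []}"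

definition unfold_dia ::
  "('p, 'a) prog \<Rightarrow> ('p, 'a) fml \<Rightarrow> ('p, 'a) fml set set" where
  "unfold_dia \<alpha> \<psi> = {Y \<union> {Neg (boxes \<delta>s \<psi>)} |Y \<delta>s. (Y, \<delta>s) \<in> Hset \<alpha>}"

subsection \<open>Loaded formulas and sequents\<close>

text \<open>
  \<open>xi\<close> is the range of the metavariable \<open>\<xi>\<close>: a plain formula below a (possibly empty)
  block of boxes with marked programs, \<open>LBox\<close> being the marked box.  Since marks only
  occur in such a block below a negation, the elements of a sequent are plain formulas
  \<open>Fml \<phi>\<close> and loaded formulas \<open>NegLBox \<alpha> \<xi>\<close>, the latter standing for the negation of the
  marked box of \<open>\<alpha>\<close> over \<open>\<xi>\<close>.
\<close>

datatype ('p, 'a) xi = Plain "('p, 'a) fml" | LBox "('p, 'a) prog" "('p, 'a) xi"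

datatype ('p, 'a) sfml = Fml "('p, 'a) fml" | NegLBox "('p, 'a) prog" "('p, 'a) xi"

type_synonym ('p, 'a) sequent = "('p, 'a) sfml set"

fun neg_xi :: "('p, 'a) xi \<Rightarrow> ('p, 'a) sfml" where
  "neg_xi (Plain \<phi>) = Fml (Neg \<phi>)"
| "neg_xi (LBox \<alpha> \<xi>) = NegLBox \<alpha> \<xi>"

definition lboxes :: "('p, 'a) prog list \<Rightarrow> ('p, 'a) xi \<Rightarrow> ('p, 'a) xi" where
  "lboxes \<delta>s \<xi> = foldr LBox \<delta>s \<xi>"

fun unmark_xi :: "('p, 'a) xi \<Rightarrow> ('p, 'a) fml" where
  "unmark_xi (Plain \<phi>) = \<phi>"
| "unmark_xi (LBox \<alpha> \<xi>) = Box \<alpha> (unmark_xi \<xi>)"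

fun unmark :: "('p, 'a) sfml \<Rightarrow> ('p, 'a) fml" where
  "unmark (Fml \<phi>) = \<phi>"
| "unmark (NegLBox \<alpha> \<xi>) = Neg (Box \<alpha> (unmark_xi \<xi>))"

definition sat_sequent ::
  "('w, 'p, 'a) kripke \<Rightarrow> 'w \<Rightarrow> ('p, 'a) sequent \<Rightarrow> bool" where
  "sat_sequent M w \<Gamma> \<longleftrightarrow> (\<forall>x\<in>\<Gamma>. sat M (unmark x) w)"

definition unfold_ldia ::
  "('p, 'a) prog \<Rightarrow> ('p, 'a) xi \<Rightarrow> ('p, 'a) sequent set" where
  "unfold_ldia \<alpha> \<xi> = {Fml ` Y \<union> {neg_xi (lboxes \<delta>s \<xi>)} |Y \<delta>s. (Y, \<delta>s) \<in> Hset \<alpha>}"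

definition loaded :: "('p, 'a) sequent \<Rightarrow> bool" where
  "loaded \<Gamma> \<longleftrightarrow> (\<exists>\<alpha> \<xi>. NegLBox \<alpha> \<xi> \<in> \<Gamma>)"

abbreviation free :: "('p, 'a) sequent \<Rightarrow> bool" where
  "free \<Gamma> \<equiv> \<not> loaded \<Gamma>"

inductive basic_sfml :: "('p, 'a) sfml \<Rightarrow> bool" where
  "basic_sfml (Fml Bot)"
| "basic_sfml (Fml (Neg Bot))"
| "basic_sfml (Fml (Prop p))"
| "basic_sfml (Fml (Neg (Prop p)))"
| "basic_sfml (Fml (Box (Atom a) \<phi>))"
| "basic_sfml (Fml (Neg (Box (Atom a) \<phi>)))"
| "basic_sfml (NegLBox (Atom a) \<xi>)"

definition basic :: "('p, 'a) sequent \<Rightarrow> bool" where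
  "basic \<Gamma> \<longleftrightarrow> (\<forall>x\<in>\<Gamma>. basic_sfml x)"

definition proj :: "'a \<Rightarrow> ('p, 'a) sequent \<Rightarrow> ('p, 'a) sequent" where
  "proj a \<Delta> = {Fml \<phi> |\<phi>. Fml (Box (Atom a) \<phi>) \<in> \<Delta>}"

definition closed_sequent :: "('p, 'a) sequent \<Rightarrow> bool" where
  "closed_sequent \<Gamma> \<longleftrightarrow> Fml Bot \<in> \<Gamma> \<or> (\<exists>\<phi>. Fml \<phi> \<in> \<Gamma> \<and> Fml (Neg \<phi>) \<in> \<Gamma>)"

subsection \<open>Rules\<close>

datatype rule = RNeg | RConj | RNegConj | RBox | RDia | RLDia | RLPlus | RLMinus | RM

text \<open>
  \<open>rule_inst r \<Gamma> C\<close>: the sequent \<open>\<Gamma>\<close> and the set \<open>C\<close> of the sequents below the line form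
  an instance of rule \<open>r\<close>.  In \<open>lplus\<close>, the maximality of the block of boxes that gets
  marked is expressed by \<open>\<phi>\<close> not being a box formula; in \<open>lminus\<close>, the block consists of
  all the marked boxes, because a loaded formula is unmarked below it.
\<close>

inductive rule_inst ::
  "rule \<Rightarrow> ('p, 'a) sequent \<Rightarrow> ('p, 'a) sequent set \<Rightarrow> bool" where
  neg: "Fml (Neg (Neg \<phi>)) \<notin> \<Delta> \<Longrightarrow>
    rule_inst RNeg (insert (Fml (Neg (Neg \<phi>))) \<Delta>) {insert (Fml \<phi>) \<Delta>}"
| conj: "Fml (Conj \<phi> \<psi>) \<notin> \<Delta> \<Longrightarrow>
    rule_inst RConj (insert (Fml (Conj \<phi> \<psi>)) \<Delta>) {insert (Fml \<phi>) (insert (Fml \<psi>) \<Delta>)}"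
| neg_conj: "Fml (Neg (Conj \<phi> \<psi>)) \<notin> \<Delta> \<Longrightarrow>
    rule_inst RNegConj (insert (Fml (Neg (Conj \<phi> \<psi>))) \<Delta>)
      {insert (Fml (Neg \<phi>)) \<Delta>, insert (Fml (Neg \<psi>)) \<Delta>}"
| box: "Fml (Box \<alpha> \<phi>) \<notin> \<Delta> \<Longrightarrow> \<not> is_atomic \<alpha> \<Longrightarrow>
    rule_inst RBox (insert (Fml (Box \<alpha> \<phi>)) \<Delta>) {\<Delta> \<union> Fml ` \<Gamma> |\<Gamma>. \<Gamma> \<in> unfold_box \<alpha> \<phi>}"
| dia: "Fml (Neg (Box \<alpha> \<phi>)) \<notin> \<Delta> \<Longrightarrow> \<not> is_atomic \<alpha> \<Longrightarrow>
    rule_inst RDia (insert (Fml (Neg (Box \<alpha> \<phi>))) \<Delta>)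
      {\<Delta> \<union> Fml ` \<Gamma> |\<Gamma>. \<Gamma> \<in> unfold_dia \<alpha> \<phi>}"
| ldia: "NegLBox \<alpha> \<xi> \<notin> \<Delta> \<Longrightarrow> \<not> is_atomic \<alpha> \<Longrightarrow>
    rule_inst RLDia (insert (NegLBox \<alpha> \<xi>) \<Delta>) {\<Delta> \<union> \<Gamma> |\<Gamma>. \<Gamma> \<in> unfold_ldia \<alpha> \<xi>}"
| lplus: "Fml (Neg (boxes (Atom a # \<alpha>s) \<phi>)) \<notin> \<Delta> \<Longrightarrow> free \<Delta> \<Longrightarrow> basic \<Delta> \<Longrightarrow>
    (\<nexists>\<beta> \<psi>. \<phi> = Box \<beta> \<psi>) \<Longrightarrow>
    rule_inst RLPlus (insert (Fml (Neg (boxes (Atom a # \<alpha>s) \<phi>))) \<Delta>)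
      {insert (neg_xi (lboxes (Atom a # \<alpha>s) (Plain \<phi>))) \<Delta>}"
| lminus: "neg_xi (lboxes \<alpha>s (Plain \<phi>)) \<notin> \<Delta> \<Longrightarrow> \<alpha>s \<noteq> [] \<Longrightarrow> basic \<Delta> \<Longrightarrow>
    rule_inst RLMinus (insert (neg_xi (lboxes \<alpha>s (Plain \<phi>))) \<Delta>)
      {insert (Fml (Neg (boxes \<alpha>s \<phi>))) \<Delta>}"
| modal: "NegLBox (Atom a) \<xi> \<notin> \<Delta> \<Longrightarrow> basic \<Delta> \<Longrightarrow>
    rule_inst RM (insert (NegLBox (Atom a) \<xi>) \<Delta>) {insert (neg_xi \<xi>) (proj a \<Delta>)}"

subsection \<open>Tableaux\<close>

text \<open>
  A rooted tree is a prefix-closed set of positions containing the root position \<open>[]\<close>; the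
  children of \<open>t\<close> are the nodes \<open>t @ [i]\<close>, its proper ancestors the strict prefixes of \<open>t\<close>.
  Trees may be infinite.  \<open>rule_at\<close> records which rule is applied at an interior node; it is
  irrelevant at leaves.
\<close>

record ('p, 'a) tableau =
  nodes :: "nat list set"
  label :: "nat list \<Rightarrow> ('p, 'a) sequent"
  rule_at :: "nat list \<Rightarrow> rule"

definition children :: "('p, 'a) tableau \<Rightarrow> nat list \<Rightarrow> nat list set" where
  "children T t = {t @ [i] |i. t @ [i] \<in> nodes T}"

definition leaf :: "('p, 'a) tableau \<Rightarrow> nat list \<Rightarrow> bool" where
  "leaf T t \<longleftrightarrow> t \<in> nodes T \<and> children T t = {}"

definition interior :: "('p, 'a) tableau \<Rightarrow> nat list \<Rightarrow> bool" where
  "interior T t \<longleftrightarrow> t \<in> nodes T \<and> children T t \<noteq> {}"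

definition is_tableau :: "('p, 'a) tableau \<Rightarrow> bool" where
  "is_tableau T \<longleftrightarrow>
     [] \<in> nodes T \<and>
     (\<forall>t i. t @ [i] \<in> nodes T \<longrightarrow> t \<in> nodes T) \<and>
     (\<forall>t\<in>nodes T. finite (label T t)) \<and>
     (\<forall>t. interior T t \<longrightarrow> rule_inst (rule_at T t) (label T t) (label T ` children T t)) \<and>
     (\<forall>t s. interior T t \<and> s \<in> children T t \<and> interior T s \<and> rule_at T t = RLPlus
        \<longrightarrow> rule_at T s \<noteq> RLMinus)"

definition repeat :: "('p, 'a) tableau \<Rightarrow> nat list \<Rightarrow> bool" where
  "repeat T t \<longleftrightarrow> t \<in> nodes T \<and> (\<exists>s. strict_prefix s t \<and> label T s = label T t)"

definition companion :: "('p, 'a) tableau \<Rightarrow> nat list \<Rightarrow> nat list \<Rightarrow> bool" where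
  "companion T c t \<longleftrightarrow> strict_prefix c t \<and> label T c = label T t \<and>
     (\<forall>s. strict_prefix s t \<and> label T s = label T t \<longrightarrow> prefix s c)"

definition loaded_path_repeat :: "('p, 'a) tableau \<Rightarrow> nat list \<Rightarrow> bool" where
  "loaded_path_repeat T t \<longleftrightarrow> repeat T t \<and>
     (\<exists>c. companion T c t \<and> (\<forall>s. prefix c s \<and> prefix s t \<longrightarrow> loaded (label T s)))"

definition free_repeat :: "('p, 'a) tableau \<Rightarrow> nat list \<Rightarrow> bool" where
  "free_repeat T t \<longleftrightarrow> repeat T t \<and> free (label T t)"

definition pdl_tableau :: "('p, 'a) tableau \<Rightarrow> bool" where
  "pdl_tableau T \<longleftrightarrow> is_tableau T \<and>
     (\<forall>t. loaded_path_repeat T t \<or> free_repeat T t \<longrightarrow> leaf T t)"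

definition closed_pdl_tableau :: "('p, 'a) tableau \<Rightarrow> bool" where
  "closed_pdl_tableau T \<longleftrightarrow> pdl_tableau T \<and>
     (\<forall>t. leaf T t \<longrightarrow> closed_sequent (label T t) \<or> loaded_path_repeat T t)"

end

theory Submission
  imports Defs
begin

text \<open>
  Fix a model.  Give a loaded formula true at \<open>w\<close> the least number of atomic steps of a path
  that witnesses it, and a sequent the sum of these ranks.  Every rule has a child that is
  again satisfied (at the same state, or at a successor for the modal rule); below a loaded
  node it can be chosen such that the rank drops, or does not grow while a local weight drops.
  Labels lie in a finite Fischer-Ladner closure and free repeats are leaves, so if some node
  is satisfied, then there is a nonempty set of satisfied, loaded nodes closed under satisfied
  children and under companions (the satisfied descendants of a deepest free satisfied node).
  Take a pair of such a node \<open>s\<close> and a state of minimal rank, with \<open>s\<close> of minimal depth.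
  Below \<open>s\<close> the rank cannot drop, so the weight decreases until a leaf is reached; the
  companion of this leaf is not above \<open>s\<close>, hence has larger weight, although the labels agree.
\<close>

section \<open>Semantics with step counting\<close>

text \<open>The count adds up the atomic steps of all iterations. An iteration built from tests
  alone contributes 0, so the count does not bound the number of iterations.\<close>

inductive star_steps :: "(nat \<Rightarrow> 'w \<Rightarrow> 'w \<Rightarrow> bool) \<Rightarrow> nat \<Rightarrow> 'w \<Rightarrow> 'w \<Rightarrow> bool"
  for R where
  refl: "star_steps R 0 w w"
| step: "R i w u \<Longrightarrow> star_steps R j u v \<Longrightarrow> star_steps R (i + j) w v"

text \<open>A refinement of \<open>prog_rel\<close> in which only atomic programs cost anything.
  Unfolding a program at a fixed state is thus free, and only the modal rule consumes a
  step.\<close>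

primrec steps :: "('w, 'p, 'a) kripke \<Rightarrow> ('p, 'a) prog \<Rightarrow> nat \<Rightarrow> 'w \<Rightarrow> 'w \<Rightarrow> bool" where
  "steps M (Atom a) = (\<lambda>n w v. n = 1 \<and> (w, v) \<in> rel M a)"
| "steps M (Test \<tau>) = (\<lambda>n w v. n = 0 \<and> w = v \<and> sat M \<tau> w)"
| "steps M (Choice \<alpha> \<beta>) = (\<lambda>n w v. steps M \<alpha> n w v \<or> steps M \<beta> n w v)"
| "steps M (Seq \<alpha> \<beta>) = (\<lambda>n w v. \<exists>i j u. n = i + j \<and> steps M \<alpha> i w u \<and> steps M \<beta> j u v)"
| "steps M (Star \<alpha>) = star_steps (steps M \<alpha>)"

lemma star_steps_iff_rtrancl:
  assumes "\<And>w v. (w, v) \<in> r \<longleftrightarrow> (\<exists>n. R n w v)"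
  shows "(w, v) \<in> r\<^sup>* \<longleftrightarrow> (\<exists>n. star_steps R n w v)"
proof
  assume "(w, v) \<in> r\<^sup>*"
  then show "\<exists>n. star_steps R n w v"
    by (induction rule: converse_rtrancl_induct) (use assms in \<open>blast intro: star_steps.intros\<close>)+
next
  assume "\<exists>n. star_steps R n w v"
  then obtain n where "star_steps R n w v" by blast
  then show "(w, v) \<in> r\<^sup>*"
    by induction (use assms in \<open>blast intro: converse_rtrancl_into_rtrancl\<close>)+
qed

lemma prog_rel_iff_steps: "(w, v) \<in> prog_rel M \<alpha> \<longleftrightarrow> (\<exists>n. steps M \<alpha> n w v)"
proof (induction \<alpha> arbitrary: w v rule: prog.induct[of "\<lambda>_. True"])
  case (Star \<alpha>)
  then show ?case by (simp add: star_steps_iff_rtrancl)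
qed (auto simp: relcomp_unfold)

primrec list_steps ::
  "('w, 'p, 'a) kripke \<Rightarrow> ('p, 'a) prog list \<Rightarrow> nat \<Rightarrow> 'w \<Rightarrow> 'w \<Rightarrow> bool" where
  "list_steps M [] n w v \<longleftrightarrow> n = 0 \<and> w = v"
| "list_steps M (\<alpha> # \<alpha>s) n w v \<longleftrightarrow>
     (\<exists>i j u. n = i + j \<and> steps M \<alpha> i w u \<and> list_steps M \<alpha>s j u v)"

text \<open>\<open>Pset\<close> and \<open>Hset\<close> append the remaining program at the end of a
  list, whereas \<open>list_steps\<close> recurses from the front.\<close>

lemma list_steps_snoc:
  "list_steps M (\<alpha>s @ [\<beta>]) n w v \<longleftrightarrow>
     (\<exists>i j u. n = i + j \<and> list_steps M \<alpha>s i w u \<and> steps M \<beta> j u v)"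
proof (induction \<alpha>s arbitrary: n w)
  case (Cons \<alpha> \<alpha>s)
  show ?case
  proof
    assume "list_steps M ((\<alpha> # \<alpha>s) @ [\<beta>]) n w v"
    then obtain i i' j x u where "n = i + (i' + j)" "steps M \<alpha> i w x"
      "list_steps M \<alpha>s i' x u" "steps M \<beta> j u v"
      using Cons by auto
    then show "\<exists>i j u. n = i + j \<and> list_steps M (\<alpha> # \<alpha>s) i w u \<and> steps M \<beta> j u v"
      by (intro exI[of _ "i + i'"] exI[of _ j] exI[of _ u]) auto
  next
    assume "\<exists>i j u. n = i + j \<and> list_steps M (\<alpha> # \<alpha>s) i w u \<and> steps M \<beta> j u v"
    then obtain k j u where k: "n = k + j" "list_steps M (\<alpha> # \<alpha>s) k w u" "steps M \<beta> j u v"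
      by blast
    then obtain i i' x where "k = i + i'" "steps M \<alpha> i w x" "list_steps M \<alpha>s i' x u"
      by auto
    with k have "n = i + (i' + j)" by simp
    have "list_steps M (\<alpha>s @ [\<beta>]) (i' + j) x v"
      using Cons k \<open>list_steps M \<alpha>s i' x u\<close> by blast
    with \<open>n = i + (i' + j)\<close> \<open>steps M \<alpha> i w x\<close>
    show "list_steps M ((\<alpha> # \<alpha>s) @ [\<beta>]) n w v" by auto
  qed
qed auto

section \<open>Semantic correctness of the two unfoldings\<close>

lemma sat_boxes: "sat M (boxes \<alpha>s \<psi>) w \<longleftrightarrow> (\<forall>n v. list_steps M \<alpha>s n w v \<longrightarrow> sat M \<psi> v)"
  by (induction \<alpha>s arbitrary: w) (auto simp: boxes_def prog_rel_iff_steps, blast)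

text \<open>A list in \<open>Pset\<close> describes one way of running \<alpha> after its initial
  tests have succeeded. For a star the appended \<open>Star \<alpha>\<close> stands for the
  remaining iterations, so one application of \<open>star_steps.step\<close> suffices. Box formulas
  carry no rank, so the number of steps may be forgotten.\<close>

lemma Pset_sound:
  assumes "\<alpha>s \<in> Pset l \<alpha>" "\<forall>\<tau>\<in>l. sat M \<tau> w" "list_steps M \<alpha>s n w v"
  shows "\<exists>m. steps M \<alpha> m w v"
  using assms
proof (induction \<alpha> arbitrary: \<alpha>s n v rule: prog.induct[of "\<lambda>_. True"])
  case (Seq \<alpha> \<beta>)
  from Seq.prems(1) consider \<beta>s where "\<alpha>s = \<beta>s @ [\<beta>]" "\<beta>s \<in> Pset l \<alpha>"
    | "\<alpha>s \<in> Pset l \<beta>" "[] \<in> Pset l \<alpha>"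
    by auto
  then show ?case
  proof cases
    case 1
    with Seq.prems obtain i j u where "list_steps M \<beta>s i w u" "steps M \<beta> j u v"
      by (auto simp: list_steps_snoc)
    with Seq.IH(1)[of \<beta>s] 1 Seq.prems(2) show ?thesis by fastforce
  next
    case 2
    from Seq.IH(1)[of "[]" 0 w] 2 Seq.prems(2) obtain i where "steps M \<alpha> i w w" by auto
    moreover from Seq.IH(2) 2 Seq.prems obtain j where "steps M \<beta> j w v" by blast
    ultimately show ?thesis by auto
  qed
next
  case (Star \<alpha>)
  from Star.prems(1) consider "\<alpha>s = []" | \<beta>s where "\<alpha>s = \<beta>s @ [Star \<alpha>]" "\<beta>s \<in> Pset l \<alpha>"
    by auto
  then show ?case
  proof cases
    case 1
    with Star.prems show ?thesis by (auto intro: star_steps.intros)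
  next
    case 2
    with Star.prems obtain i j u where "list_steps M \<beta>s i w u" "star_steps (steps M \<alpha>) j u v"
      by (auto simp: list_steps_snoc)
    with Star.IH[of \<beta>s] 2 Star.prems(2) show ?thesis by (fastforce intro: star_steps.step)
  qed
qed (fastforce split: if_splits)+

text \<open>Induction on \<alpha>, splitting off the tests passed before the first atomic step. The
  same \<open>n\<close> on both sides is essential: it keeps the rank from growing when a loaded
  diamond is unfolded.\<close>

lemma Hset_complete:
  assumes "steps M \<alpha> n w v"
  shows "\<exists>Y \<delta>s. (Y, \<delta>s) \<in> Hset \<alpha> \<and> (\<forall>\<tau>\<in>Y. sat M \<tau> w) \<and> list_steps M \<delta>s n w v"
  using assms
proof (induction \<alpha> arbitrary: n w v rule: prog.induct[of "\<lambda>_. True"])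
  case (Atom a)
  then show ?case by auto
next
  case (Test \<tau>)
  then show ?case by auto
next
  case (Choice \<alpha> \<beta>)
  then show ?case by (simp, blast)
next
  case (Seq \<alpha> \<beta>)
  then obtain i j u where n: "n = i + j" "steps M \<alpha> i w u" "steps M \<beta> j u v" by auto
  with Seq.IH(1) obtain Y \<delta>s where Y: "(Y, \<delta>s) \<in> Hset \<alpha>" "\<forall>\<tau>\<in>Y. sat M \<tau> w"
    "list_steps M \<delta>s i w u" by blast
  show ?case
  proof (cases "\<delta>s = []")
    case True
    with Y n have "u = w" "i = 0" by auto
    from Seq.IH(2)[OF n(3)] obtain Z \<epsilon>s where Z: "(Z, \<epsilon>s) \<in> Hset \<beta>" "\<forall>\<tau>\<in>Z. sat M \<tau> u"
      "list_steps M \<epsilon>s j u v" by blast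
    with Y True have "(Y \<union> Z, \<epsilon>s) \<in> Hset (Seq \<alpha> \<beta>)" by auto
    with Y Z \<open>u = w\<close> \<open>i = 0\<close> n show ?thesis by (intro exI[of _ "Y \<union> Z"] exI[of _ \<epsilon>s]) auto
  next
    case False
    with Y have "(Y, \<delta>s @ [\<beta>]) \<in> Hset (Seq \<alpha> \<beta>)" by auto
    moreover have "list_steps M (\<delta>s @ [\<beta>]) n w v" using Y n by (auto simp: list_steps_snoc)
    ultimately show ?thesis using Y by blast
  qed
next
  case (Star \<alpha>)
  from Star.prems have "star_steps (steps M \<alpha>) n w v" by simp
  then show ?case
  proof induction
    case (refl w)
    show ?case by (intro exI[of _ "{}"] exI[of _ "[]"]) auto
  next
    case (step i w u j v)
    from Star.IH[OF step.hyps(1)] obtain Y \<delta>s where Y: "(Y, \<delta>s) \<in> Hset \<alpha>" "\<forall>\<tau>\<in>Y. sat M \<tau> w"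
      "list_steps M \<delta>s i w u" by blast
    show ?case
    proof (cases "\<delta>s = []")
      case True
      with Y step.IH show ?thesis by simp
    next
      case False
      with Y have "(Y, \<delta>s @ [Star \<alpha>]) \<in> Hset (Star \<alpha>)" by auto
      moreover have "list_steps M (\<delta>s @ [Star \<alpha>]) (i + j) w v"
        using Y step.hyps by (auto simp: list_steps_snoc)
      ultimately show ?thesis using Y by blast
    qed
  qed
qed simp_all

lemma unfold_box_sound:
  assumes "sat M (Box \<alpha> \<psi>) w"
  shows "\<exists>\<Gamma>\<in>unfold_box \<alpha> \<psi>. \<forall>\<phi>\<in>\<Gamma>. sat M \<phi> w"
proof -
  \<comment> \<open>The child to follow is determined by the tests true at \<open>w\<close>: this
    makes \<open>Fset\<close> true and satisfies the premise of \<open>Pset_sound\<close>.\<close>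
  define l where "l = {\<tau> \<in> Tests \<alpha>. sat M \<tau> w}"
  have "sat M (boxes \<alpha>s \<psi>) w" if "\<alpha>s \<in> Pset l \<alpha>" for \<alpha>s
    unfolding sat_boxes
  proof (intro allI impI)
    fix n v
    assume "list_steps M \<alpha>s n w v"
    with Pset_sound[OF that, of M w] have "\<exists>m. steps M \<alpha> m w v" by (auto simp: l_def)
    with assms show "sat M \<psi> v" by (simp add: prog_rel_iff_steps)
  qed
  then have "\<forall>\<phi>\<in>Xset l \<alpha> \<psi>. sat M \<phi> w"
    by (auto simp: Xset_def Fset_def l_def)
  moreover have "Xset l \<alpha> \<psi> \<in> unfold_box \<alpha> \<psi>" by (auto simp: unfold_box_def l_def)
  ultimately show ?thesis by blast
qed

lemma unfold_dia_sound:
  assumes "sat M (Neg (Box \<alpha> \<psi>)) w"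
  shows "\<exists>\<Gamma>\<in>unfold_dia \<alpha> \<psi>. \<forall>\<phi>\<in>\<Gamma>. sat M \<phi> w"
proof -
  from assms obtain n v where v: "steps M \<alpha> n w v" "\<not> sat M \<psi> v"
    by (auto simp: prog_rel_iff_steps)
  from Hset_complete[OF v(1)] obtain Y \<delta>s where Y: "(Y, \<delta>s) \<in> Hset \<alpha>" "\<forall>\<tau>\<in>Y. sat M \<tau> w"
    "list_steps M \<delta>s n w v" by blast
  then have "sat M (Neg (boxes \<delta>s \<psi>)) w" using v by (auto simp: sat_boxes)
  moreover have "Y \<union> {Neg (boxes \<delta>s \<psi>)} \<in> unfold_dia \<alpha> \<psi>"
    using Y by (auto simp: unfold_dia_def)
  ultimately show ?thesis using Y by (intro bexI[of _ "Y \<union> {Neg (boxes \<delta>s \<psi>)}"]) auto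
qed

section \<open>Ranks of loaded formulas\<close>

text \<open>Truth of the negation of \<xi> at a state, refined by the number of atomic steps on a
  path that runs through the marked programs and refutes the plain formula below them.\<close>

primrec wit :: "('w, 'p, 'a) kripke \<Rightarrow> ('p, 'a) xi \<Rightarrow> nat \<Rightarrow> 'w \<Rightarrow> bool" where
  "wit M (Plain \<phi>) = (\<lambda>n w. n = 0 \<and> \<not> sat M \<phi> w)"
| "wit M (LBox \<alpha> \<xi>) = (\<lambda>n w. \<exists>i j v. n = i + j \<and> steps M \<alpha> i w v \<and> wit M \<xi> j v)"

lemma ex_wit_iff: "(\<exists>n. wit M \<xi> n w) \<longleftrightarrow> \<not> sat M (unmark_xi \<xi>) w"
proof (induction \<xi> arbitrary: w)
  case (LBox \<alpha> \<xi>)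
  have "(\<exists>n. wit M (LBox \<alpha> \<xi>) n w) \<longleftrightarrow> (\<exists>v. (\<exists>i. steps M \<alpha> i w v) \<and> (\<exists>j. wit M \<xi> j v))"
    by auto
  then show ?case by (simp add: LBox prog_rel_iff_steps)
qed simp_all

lemma wit_lboxes:
  "wit M (lboxes \<delta>s \<xi>) n w \<longleftrightarrow> (\<exists>i j v. n = i + j \<and> list_steps M \<delta>s i w v \<and> wit M \<xi> j v)"
proof (induction \<delta>s arbitrary: n w)
  case (Cons \<delta> \<delta>s)
  have "wit M (lboxes (\<delta> # \<delta>s) \<xi>) n w \<longleftrightarrow>
      (\<exists>i j u. n = i + j \<and> steps M \<delta> i w u \<and> wit M (lboxes \<delta>s \<xi>) j u)"
    by (simp add: lboxes_def)
  also have "\<dots> \<longleftrightarrow> (\<exists>i j k u v. n = i + (j + k) \<and> steps M \<delta> i w u \<and>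
      list_steps M \<delta>s j u v \<and> wit M \<xi> k v)"
    unfolding Cons by blast
  also have "\<dots> \<longleftrightarrow> (\<exists>i j v. n = i + j \<and> list_steps M (\<delta> # \<delta>s) i w v \<and> wit M \<xi> j v)"
  proof
    assume "\<exists>i j k u v. n = i + (j + k) \<and> steps M \<delta> i w u \<and> list_steps M \<delta>s j u v \<and> wit M \<xi> k v"
    then obtain i j k u v where "n = (i + j) + k" "steps M \<delta> i w u" "list_steps M \<delta>s j u v" "wit M \<xi> k v"
      by (auto simp: add.assoc)
    then show "\<exists>i j v. n = i + j \<and> list_steps M (\<delta> # \<delta>s) i w v \<and> wit M \<xi> j v"
      unfolding list_steps.simps by blast
  next
    assume "\<exists>i j v. n = i + j \<and> list_steps M (\<delta> # \<delta>s) i w v \<and> wit M \<xi> j v"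
    then obtain i j k u v where "n = (i + j) + k" "steps M \<delta> i w u" "list_steps M \<delta>s j u v" "wit M \<xi> k v"
      by auto
    then show "\<exists>i j k u v. n = i + (j + k) \<and> steps M \<delta> i w u \<and> list_steps M \<delta>s j u v \<and> wit M \<xi> k v"
      by (metis add.assoc)
  qed
  finally show ?case .
qed (simp add: lboxes_def)

text \<open>The least length of a witnessing path. If the loaded formula is false at
  \<open>w\<close>, the value is unspecified; \<open>rank_attained\<close> therefore asks for its
  truth.\<close>

primrec rank :: "('w, 'p, 'a) kripke \<Rightarrow> 'w \<Rightarrow> ('p, 'a) sfml \<Rightarrow> nat" where
  "rank M w (Fml \<phi>) = 0"
| "rank M w (NegLBox \<alpha> \<xi>) = (LEAST n. wit M (LBox \<alpha> \<xi>) n w)"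

text \<open>Summing over all elements also covers sequents with several loaded formulas.\<close>

definition seq_rank :: "('w, 'p, 'a) kripke \<Rightarrow> 'w \<Rightarrow> ('p, 'a) sequent \<Rightarrow> nat" where
  "seq_rank M w \<Gamma> = (\<Sum>x\<in>\<Gamma>. rank M w x)"

lemma unmark_neg_xi: "unmark (neg_xi \<xi>) = Neg (unmark_xi \<xi>)"
  by (cases \<xi>) auto

lemma unmark_lboxes: "unmark_xi (lboxes \<delta>s \<xi>) = boxes \<delta>s (unmark_xi \<xi>)"
  by (induction \<delta>s) (auto simp: lboxes_def boxes_def)

lemma rank_neg_xi_le: "wit M \<xi> n w \<Longrightarrow> rank M w (neg_xi \<xi>) \<le> n"
  by (cases \<xi>) (auto intro: Least_le simp del: wit.simps)

lemma rank_attained: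
  assumes "sat M (unmark (NegLBox \<alpha> \<xi>)) w"
  shows "\<exists>i j v. rank M w (NegLBox \<alpha> \<xi>) = i + j \<and> steps M \<alpha> i w v \<and> wit M \<xi> j v"
proof -
  have "\<exists>n. wit M (LBox \<alpha> \<xi>) n w" using assms ex_wit_iff[of M "LBox \<alpha> \<xi>" w] by simp
  then have "wit M (LBox \<alpha> \<xi>) (rank M w (NegLBox \<alpha> \<xi>)) w"
    unfolding rank.simps by (rule LeastI_ex)
  then show ?thesis by simp
qed

section \<open>The local weight\<close>

text \<open>
  \<open>wt \<phi> True\<close> weighs \<open>\<phi>\<close> and \<open>wt \<phi> False\<close> weighs its negation.  Formulas \<open>[a]\<phi>\<close> and their
  negations weigh nothing, so it does not matter how many of them an unfolding creates.
\<close>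

primrec wt :: "('p, 'a) fml \<Rightarrow> bool \<Rightarrow> nat"
  and tests_wt :: "('p, 'a) prog \<Rightarrow> bool \<Rightarrow> nat" where
  "wt Bot = (\<lambda>b. 0)"
| "wt (Prop p) = (\<lambda>b. 0)"
| "wt (Neg \<phi>) = (\<lambda>b. if b then wt \<phi> False else Suc (wt \<phi> True))"
| "wt (Conj \<phi> \<psi>) = (\<lambda>b. Suc (wt \<phi> b + wt \<psi> b))"
| "wt (Box \<alpha> \<psi>) = (\<lambda>b. if is_atomic \<alpha> then 0 else Suc (tests_wt \<alpha> (\<not> b) + wt \<psi> b))"
| "tests_wt (Atom a) = (\<lambda>b. 0)"
| "tests_wt (Test \<tau>) = (\<lambda>b. wt \<tau> b)"
| "tests_wt (Choice \<alpha> \<beta>) = (\<lambda>b. tests_wt \<alpha> b + tests_wt \<beta> b)"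
| "tests_wt (Seq \<alpha> \<beta>) = (\<lambda>b. tests_wt \<alpha> b + tests_wt \<beta> b)"
| "tests_wt (Star \<alpha>) = (\<lambda>b. tests_wt \<alpha> b)"

text \<open>The extra \<open>Suc\<close> for loaded formulas makes the rule \<open>L-\<close> decrease the weight.\<close>

primrec sfml_wt :: "('p, 'a) sfml \<Rightarrow> nat" where
  "sfml_wt (Fml \<phi>) = wt \<phi> True"
| "sfml_wt (NegLBox \<alpha> \<xi>) = Suc (wt (Box \<alpha> (unmark_xi \<xi>)) False)"

definition seq_wt :: "('p, 'a) sequent \<Rightarrow> nat" where
  "seq_wt \<Gamma> = (\<Sum>x\<in>\<Gamma>. sfml_wt x)"

lemma sum_Un_le_nat:
  fixes f :: "'b \<Rightarrow> nat"
  shows "finite A \<Longrightarrow> finite B \<Longrightarrow> sum f (A \<union> B) \<le> sum f A + sum f B"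
  using sum.union_inter[of A B f] by linarith

lemma sum_insert_le_nat:
  fixes f :: "'b \<Rightarrow> nat"
  shows "finite A \<Longrightarrow> sum f (insert x A) \<le> f x + sum f A"
  by (cases "x \<in> A") (auto simp: insert_absorb)

section \<open>Weights of the sets produced by unfolding\<close>

lemma finite_Tests: "finite (Tests \<alpha>)"
  by (induction \<alpha> rule: prog.induct[of "\<lambda>_. True"]) auto

text \<open>Only an inequality, because a test occurring several times in \<alpha> is counted once
  in the set \<open>Tests \<alpha>\<close>.\<close>

lemma sum_Tests_le: "(\<Sum>\<tau>\<in>Tests \<alpha>. wt \<tau> b) \<le> tests_wt \<alpha> b"
proof (induction \<alpha> rule: prog.induct[of "\<lambda>_. True"])
  case (Choice \<alpha> \<beta>)
  with sum_Un_le_nat[of "Tests \<alpha>" "Tests \<beta>" "\<lambda>\<tau>. wt \<tau> b"] show ?case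
    by (simp add: finite_Tests)
next
  case (Seq \<alpha> \<beta>)
  with sum_Un_le_nat[of "Tests \<alpha>" "Tests \<beta>" "\<lambda>\<tau>. wt \<tau> b"] show ?case
    by (simp add: finite_Tests)
qed auto

lemma Hset_Tests: "(Y, \<delta>s) \<in> Hset \<alpha> \<Longrightarrow> Y \<subseteq> Tests \<alpha>"
  by (induction \<alpha> arbitrary: Y \<delta>s rule: prog.induct[of "\<lambda>_. True"]) (auto, blast+)

text \<open>Unfolding continues until an atomic program is in front. Hence every box formula built
  from a nonempty list weighs 0, however many such lists there are.\<close>

lemma Hset_hd_atomic: "(Y, \<delta>s) \<in> Hset \<alpha> \<Longrightarrow> \<delta>s \<noteq> [] \<Longrightarrow> is_atomic (hd \<delta>s)"
  by (induction \<alpha> arbitrary: Y \<delta>s rule: prog.induct[of "\<lambda>_. True"]) (auto simp: is_atomic_def)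

lemma Pset_hd_atomic: "\<delta>s \<in> Pset l \<alpha> \<Longrightarrow> \<delta>s \<noteq> [] \<Longrightarrow> is_atomic (hd \<delta>s)"
  by (induction \<alpha> arbitrary: \<delta>s rule: prog.induct[of "\<lambda>_. True"])
    (auto simp: is_atomic_def split: if_splits)

lemma wt_boxes_atomic: "\<delta>s \<noteq> [] \<Longrightarrow> is_atomic (hd \<delta>s) \<Longrightarrow> wt (boxes \<delta>s \<psi>) b = 0"
  by (cases \<delta>s) (auto simp: boxes_def)

lemma wt_boxes_Hset_le: "(Y, \<delta>s) \<in> Hset \<alpha> \<Longrightarrow> wt (boxes \<delta>s \<psi>) b \<le> wt \<psi> b"
  using Hset_hd_atomic[of Y \<delta>s \<alpha>] wt_boxes_atomic[of \<delta>s]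
  by (cases "\<delta>s = []") (auto simp: boxes_def)

lemma sum_Hset_le: "(Y, \<delta>s) \<in> Hset \<alpha> \<Longrightarrow> (\<Sum>\<tau>\<in>Y. wt \<tau> b) \<le> tests_wt \<alpha> b"
  using sum_mono2[OF finite_Tests Hset_Tests, of Y \<delta>s \<alpha> "\<lambda>\<tau>. wt \<tau> b"] sum_Tests_le[of b \<alpha>]
  by auto

text \<open>The negated tests pay at most \<open>tests_wt \<alpha> False\<close>. Among the box
  formulas, nonempty lists give weight 0, and the empty list gives \<psi> itself, which a set
  contains at most once.\<close>

lemma unfold_box_wt_le:
  assumes "\<Gamma> \<in> unfold_box \<alpha> \<psi>" "finite \<Gamma>"
  shows "(\<Sum>\<phi>\<in>\<Gamma>. wt \<phi> True) \<le> tests_wt \<alpha> False + wt \<psi> True"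
proof -
  from assms obtain l where \<Gamma>: "\<Gamma> = Fset l \<alpha> \<union> {boxes \<alpha>s \<psi> |\<alpha>s. \<alpha>s \<in> Pset l \<alpha>}" (is "_ = _ \<union> ?B")
    by (auto simp: unfold_box_def Xset_def)
  have fin: "finite (Fset l \<alpha>)" "finite ?B" using assms \<Gamma> by auto
  have "Fset l \<alpha> \<subseteq> Neg ` Tests \<alpha>" by (auto simp: Fset_def)
  then have "(\<Sum>\<phi>\<in>Fset l \<alpha>. wt \<phi> True) \<le> (\<Sum>\<phi>\<in>Neg ` Tests \<alpha>. wt \<phi> True)"
    by (intro sum_mono2) (auto simp: finite_Tests)
  also have "\<dots> = (\<Sum>\<tau>\<in>Tests \<alpha>. wt \<tau> False)"
    by (subst sum.reindex) (auto simp: inj_on_def)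
  finally have F: "(\<Sum>\<phi>\<in>Fset l \<alpha>. wt \<phi> True) \<le> tests_wt \<alpha> False"
    using sum_Tests_le[of False \<alpha>] by linarith
  have zero: "wt \<phi> True = 0" if "\<phi> \<in> ?B - {\<psi>}" for \<phi>
  proof -
    from that obtain \<alpha>s where \<alpha>s: "\<phi> = boxes \<alpha>s \<psi>" "\<alpha>s \<in> Pset l \<alpha>" "\<phi> \<noteq> \<psi>"
      by auto
    then have "\<alpha>s \<noteq> []" by (auto simp: boxes_def)
    with \<alpha>s show ?thesis using Pset_hd_atomic wt_boxes_atomic by metis
  qed
  have "(\<Sum>\<phi>\<in>?B. wt \<phi> True) \<le> (\<Sum>\<phi>\<in>insert \<psi> (?B - {\<psi>}). wt \<phi> True)"
    using fin by (intro sum_mono2) auto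
  also have "\<dots> = wt \<psi> True + (\<Sum>\<phi>\<in>?B - {\<psi>}. wt \<phi> True)"
    using fin by (subst sum.insert) auto
  also have "(\<Sum>\<phi>\<in>?B - {\<psi>}. wt \<phi> True) = 0" by (intro sum.neutral ballI zero)
  finally show ?thesis using F sum_Un_le_nat[OF fin, of "\<lambda>\<phi>. wt \<phi> True"] unfolding \<Gamma> by linarith
qed

lemma unfold_dia_wt_le:
  assumes "\<Gamma> \<in> unfold_dia \<alpha> \<psi>" "finite \<Gamma>"
  shows "(\<Sum>\<phi>\<in>\<Gamma>. wt \<phi> True) \<le> tests_wt \<alpha> True + wt \<psi> False"
proof -
  from assms obtain Y \<delta>s where Y: "\<Gamma> = insert (Neg (boxes \<delta>s \<psi>)) Y" "(Y, \<delta>s) \<in> Hset \<alpha>"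
    by (auto simp: unfold_dia_def)
  then have "(\<Sum>\<phi>\<in>\<Gamma>. wt \<phi> True) \<le> wt (boxes \<delta>s \<psi>) False + (\<Sum>\<phi>\<in>Y. wt \<phi> True)"
    using assms(2) sum_insert_le_nat[of Y "\<lambda>\<phi>. wt \<phi> True" "Neg (boxes \<delta>s \<psi>)"] by simp
  with wt_boxes_Hset_le[OF Y(2), of \<psi> False] sum_Hset_le[OF Y(2), of True]
  show ?thesis by linarith
qed

lemma sfml_wt_neg_xi_le: "sfml_wt (neg_xi \<xi>) \<le> Suc (wt (unmark_xi \<xi>) False)"
  by (cases \<xi>) auto

section \<open>Weight, rank and truth of extended sequents\<close>

lemma seq_wt_insert: "finite \<Delta> \<Longrightarrow> x \<notin> \<Delta> \<Longrightarrow> seq_wt (insert x \<Delta>) = sfml_wt x + seq_wt \<Delta>"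
  by (simp add: seq_wt_def)

lemma seq_wt_insert_le: "finite \<Delta> \<Longrightarrow> seq_wt (insert x \<Delta>) \<le> sfml_wt x + seq_wt \<Delta>"
  by (simp add: seq_wt_def sum_insert_le_nat)

lemma seq_wt_Un_Fml_le:
  assumes "finite \<Delta>" "finite \<Gamma>"
  shows "seq_wt (\<Delta> \<union> Fml ` \<Gamma>) \<le> seq_wt \<Delta> + (\<Sum>\<phi>\<in>\<Gamma>. wt \<phi> True)"
proof -
  have "(\<Sum>x\<in>Fml ` \<Gamma>. sfml_wt x) = (\<Sum>\<phi>\<in>\<Gamma>. wt \<phi> True)"
    by (subst sum.reindex) (auto simp: inj_on_def)
  with sum_Un_le_nat[of \<Delta> "Fml ` \<Gamma>" sfml_wt] assms show ?thesis by (simp add: seq_wt_def)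
qed

lemma seq_rank_insert:
  "finite \<Delta> \<Longrightarrow> x \<notin> \<Delta> \<Longrightarrow> seq_rank M w (insert x \<Delta>) = rank M w x + seq_rank M w \<Delta>"
  by (simp add: seq_rank_def)

lemma seq_rank_insert_le:
  "finite \<Delta> \<Longrightarrow> seq_rank M w (insert x \<Delta>) \<le> rank M w x + seq_rank M w \<Delta>"
  by (simp add: seq_rank_def sum_insert_le_nat)

lemma seq_rank_Un_Fml: "finite \<Delta> \<Longrightarrow> finite \<Gamma> \<Longrightarrow> seq_rank M w (\<Delta> \<union> Fml ` \<Gamma>) = seq_rank M w \<Delta>"
  unfolding seq_rank_def by (rule sum.mono_neutral_right) auto

lemma sat_sequent_insert:
  "sat_sequent M w (insert x \<Delta>) \<longleftrightarrow> sat M (unmark x) w \<and> sat_sequent M w \<Delta>"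
  by (auto simp: sat_sequent_def)

lemma sat_sequent_Un_Fml:
  "sat_sequent M w (\<Delta> \<union> Fml ` \<Gamma>) \<longleftrightarrow> sat_sequent M w \<Delta> \<and> (\<forall>\<phi>\<in>\<Gamma>. sat M \<phi> w)"
  by (simp add: sat_sequent_def ball_Un)

section \<open>Rules preserve satisfiability\<close>

lemma finite_Fml_image: "finite (\<Delta> \<union> Fml ` \<Gamma>) \<Longrightarrow> finite \<Gamma>"
  by (auto intro: finite_imageD simp: inj_on_def)

text \<open>The modal rule moves along a shortest witnessing path, which lowers the rank. All other
  rules stay at \<open>w\<close>; apart from \<open>lplus\<close>, which starts from a free sequent,
  they do not raise the rank and replace the principal formula by something lighter.\<close>

lemma rule_inst_step:
  assumes "rule_inst r \<Gamma> C" "finite \<Gamma>" "\<And>\<Gamma>'. \<Gamma>' \<in> C \<Longrightarrow> finite \<Gamma>'" "sat_sequent M w \<Gamma>"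
  shows "\<exists>\<Gamma>'\<in>C. \<exists>v. sat_sequent M v \<Gamma>' \<and>
    (loaded \<Gamma> \<longrightarrow> seq_rank M v \<Gamma>' < seq_rank M w \<Gamma> \<or>
       seq_rank M v \<Gamma>' \<le> seq_rank M w \<Gamma> \<and> seq_wt \<Gamma>' < seq_wt \<Gamma>)"
  using assms
proof cases
  case (neg \<phi> \<Delta>)
  with assms have "finite \<Delta>" by simp
  with neg assms(4) show ?thesis
    using seq_wt_insert_le[of \<Delta> "Fml \<phi>"] seq_rank_insert_le[of \<Delta> M w "Fml \<phi>"]
    by (auto simp: sat_sequent_insert seq_wt_insert seq_rank_insert intro!: exI[of _ w])
next
  case (conj \<phi> \<psi> \<Delta>)
  with assms have "finite \<Delta>" by simp
  with conj assms(4) show ?thesis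
    using seq_wt_insert_le[of \<Delta> "Fml \<psi>"] seq_rank_insert_le[of \<Delta> M w "Fml \<psi>"]
      seq_wt_insert_le[of "insert (Fml \<psi>) \<Delta>" "Fml \<phi>"]
      seq_rank_insert_le[of "insert (Fml \<psi>) \<Delta>" M w "Fml \<phi>"]
    by (auto simp: sat_sequent_insert seq_wt_insert seq_rank_insert intro!: exI[of _ w])
next
  case (neg_conj \<phi> \<psi> \<Delta>)
  with assms have fin: "finite \<Delta>" by simp
  from neg_conj assms(4) obtain \<chi> where \<chi>: "\<chi> \<in> {\<phi>, \<psi>}" "\<not> sat M \<chi> w" "sat_sequent M w \<Delta>"
    by (auto simp: sat_sequent_insert)
  have "insert (Fml (Neg \<chi>)) \<Delta> \<in> C" using \<chi> neg_conj by auto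
  moreover have "sat_sequent M w (insert (Fml (Neg \<chi>)) \<Delta>)"
    using \<chi> by (simp add: sat_sequent_insert)
  moreover have "seq_rank M w (insert (Fml (Neg \<chi>)) \<Delta>) \<le> seq_rank M w \<Gamma>"
    using fin neg_conj seq_rank_insert_le[of \<Delta> M w "Fml (Neg \<chi>)"] by (simp add: seq_rank_insert)
  moreover have "seq_wt (insert (Fml (Neg \<chi>)) \<Delta>) < seq_wt \<Gamma>"
    using fin neg_conj \<chi>(1) seq_wt_insert_le[of \<Delta> "Fml (Neg \<chi>)"] by (auto simp: seq_wt_insert)
  ultimately show ?thesis by blast
next
  case (box \<alpha> \<phi> \<Delta>)
  with assms have fin: "finite \<Delta>" by simp
  from box assms(4) unfold_box_sound[of M \<alpha> \<phi> w] obtain G where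
    G: "G \<in> unfold_box \<alpha> \<phi>" "\<forall>\<phi>\<in>G. sat M \<phi> w" "sat_sequent M w \<Delta>"
    by (auto simp: sat_sequent_insert)
  have C: "\<Delta> \<union> Fml ` G \<in> C" using G box by auto
  have finG: "finite G" using assms(3)[OF C] by (rule finite_Fml_image)
  have "sat_sequent M w (\<Delta> \<union> Fml ` G)" using G by (simp add: sat_sequent_Un_Fml)
  moreover have "seq_rank M w (\<Delta> \<union> Fml ` G) \<le> seq_rank M w \<Gamma>"
    using fin finG box by (simp add: seq_rank_insert seq_rank_Un_Fml)
  moreover have "seq_wt (\<Delta> \<union> Fml ` G) < seq_wt \<Gamma>"
    using fin box seq_wt_Un_Fml_le[OF fin finG] unfold_box_wt_le[OF G(1) finG]
    by (simp add: seq_wt_insert)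
  ultimately show ?thesis using C by blast
next
  case (dia \<alpha> \<phi> \<Delta>)
  with assms have fin: "finite \<Delta>" by simp
  from dia assms(4) unfold_dia_sound[of M \<alpha> \<phi> w] obtain G where
    G: "G \<in> unfold_dia \<alpha> \<phi>" "\<forall>\<phi>\<in>G. sat M \<phi> w" "sat_sequent M w \<Delta>"
    by (auto simp: sat_sequent_insert)
  have C: "\<Delta> \<union> Fml ` G \<in> C" using G dia by auto
  have finG: "finite G" using assms(3)[OF C] by (rule finite_Fml_image)
  have "sat_sequent M w (\<Delta> \<union> Fml ` G)" using G by (simp add: sat_sequent_Un_Fml)
  moreover have "seq_rank M w (\<Delta> \<union> Fml ` G) \<le> seq_rank M w \<Gamma>"
    using fin finG dia by (simp add: seq_rank_insert seq_rank_Un_Fml)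
  moreover have "seq_wt (\<Delta> \<union> Fml ` G) < seq_wt \<Gamma>"
    using fin dia seq_wt_Un_Fml_le[OF fin finG] unfold_dia_wt_le[OF G(1) finG]
    by (simp add: seq_wt_insert)
  ultimately show ?thesis using C by blast
next
  case (ldia \<alpha> \<xi> \<Delta>)
  with assms have fin: "finite \<Delta>" by simp
  from ldia assms(4) have sat: "sat M (unmark (NegLBox \<alpha> \<xi>)) w" "sat_sequent M w \<Delta>"
    by (auto simp: sat_sequent_insert)
  from rank_attained[OF sat(1)] obtain i j v where
    r: "rank M w (NegLBox \<alpha> \<xi>) = i + j" "steps M \<alpha> i w v" "wit M \<xi> j v" by blast
  \<comment> \<open>The child is read off a shortest witnessing path. Its \<open>i\<close> steps
    through \<alpha> become \<open>i\<close> steps through \<open>\<delta>s\<close>, so the new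
    formula has a witness of the same total length.\<close>
  from Hset_complete[OF r(2)] obtain Y \<delta>s where Y: "(Y, \<delta>s) \<in> Hset \<alpha>" "\<forall>\<tau>\<in>Y. sat M \<tau> w"
    "list_steps M \<delta>s i w v" by blast
  define x where "x = neg_xi (lboxes \<delta>s \<xi>)"
  let ?G = "insert x (\<Delta> \<union> Fml ` Y)"
  have "?G = \<Delta> \<union> (Fml ` Y \<union> {x})" by auto
  then have C: "?G \<in> C" using Y(1) ldia by (auto simp: unfold_ldia_def x_def)
  have finY: "finite Y" using assms(3)[OF C] by (auto intro: finite_Fml_image)
  have wit: "wit M (lboxes \<delta>s \<xi>) (i + j) w" using Y r by (auto simp: wit_lboxes)
  then have "sat M (unmark x) w"
    using ex_wit_iff[of M "lboxes \<delta>s \<xi>" w] by (auto simp: x_def unmark_neg_xi)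
  then have "sat_sequent M w ?G" using Y sat by (simp add: sat_sequent_insert sat_sequent_Un_Fml)
  moreover have "seq_rank M w ?G \<le> seq_rank M w \<Gamma>"
    using seq_rank_insert_le[of "\<Delta> \<union> Fml ` Y" M w x] rank_neg_xi_le[OF wit] r fin finY ldia
    by (simp add: seq_rank_insert seq_rank_Un_Fml x_def del: rank.simps)
  moreover have "seq_wt ?G < seq_wt \<Gamma>"
    using seq_wt_insert_le[of "\<Delta> \<union> Fml ` Y" x] seq_wt_Un_Fml_le[OF fin finY] fin finY ldia
      sfml_wt_neg_xi_le[of "lboxes \<delta>s \<xi>"] wt_boxes_Hset_le[OF Y(1), of "unmark_xi \<xi>" False]
      sum_Hset_le[OF Y(1), of True]
    by (simp add: seq_wt_insert x_def unmark_lboxes)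
  ultimately show ?thesis using C by blast
next
  case (lplus a \<alpha>s \<phi> \<Delta>)
  \<comment> \<open>The context is free and the principal formula is plain, so only satisfiability
    of the child is at stake.\<close>
  then have "\<not> loaded \<Gamma>" by (auto simp: loaded_def)
  with lplus assms(4) show ?thesis
    by (auto simp: sat_sequent_insert unmark_neg_xi unmark_lboxes intro!: exI[of _ w])
next
  case (lminus \<alpha>s \<phi> \<Delta>)
  with assms have fin: "finite \<Delta>" by simp
  let ?x = "neg_xi (lboxes \<alpha>s (Plain \<phi>))" and ?y = "Fml (Neg (boxes \<alpha>s \<phi>))"
  from lminus have "sfml_wt ?y < sfml_wt ?x"
    by (cases \<alpha>s) (auto simp: lboxes_def boxes_def unmark_lboxes[unfolded lboxes_def boxes_def])
  then have "seq_wt (insert ?y \<Delta>) < seq_wt \<Gamma>"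
    using fin lminus seq_wt_insert_le[OF fin, of ?y] by (simp add: seq_wt_insert)
  moreover have "seq_rank M w (insert ?y \<Delta>) \<le> seq_rank M w \<Gamma>"
    using fin lminus seq_rank_insert_le[OF fin, of M w ?y] by (simp add: seq_rank_insert)
  moreover have "sat_sequent M w (insert ?y \<Delta>)"
    using lminus assms(4) by (simp add: sat_sequent_insert unmark_neg_xi unmark_lboxes)
  ultimately show ?thesis using lminus by blast
next
  case (modal a \<xi> \<Delta>)
  with assms have fin: "finite \<Delta>" by simp
  from modal assms(4) have sat: "sat M (unmark (NegLBox (Atom a) \<xi>)) w" "sat_sequent M w \<Delta>"
    by (auto simp: sat_sequent_insert)
  from rank_attained[OF sat(1)] obtain j v where
    r: "rank M w (NegLBox (Atom a) \<xi>) = 1 + j" "(w, v) \<in> rel M a" "wit M \<xi> j v" by auto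
  let ?G = "insert (neg_xi \<xi>) (proj a \<Delta>)"
  have "sat M (unmark (neg_xi \<xi>)) v" using ex_wit_iff[of M \<xi> v] r by (auto simp: unmark_neg_xi)
  moreover have "sat_sequent M v (proj a \<Delta>)"
    using sat(2) r(2) by (fastforce simp: sat_sequent_def proj_def)
  ultimately have "sat_sequent M v ?G" by (simp add: sat_sequent_insert)
  moreover have "seq_rank M v ?G < seq_rank M w \<Gamma>"
  proof -
    have "finite (proj a \<Delta>)" using assms(3)[of ?G] modal by simp
    \<comment> \<open>\<open>proj\<close> yields plain formulas only, so the whole rank of the child
      comes from \<open>neg_xi \<xi>\<close>. This is at most \<open>j\<close>, whereas the
      principal formula has rank \<open>1 + j\<close>.\<close>
    moreover have "seq_rank M v (proj a \<Delta>) = 0" 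
      unfolding seq_rank_def by (rule sum.neutral) (auto simp: proj_def)
    ultimately show ?thesis
      using seq_rank_insert_le[of "proj a \<Delta>" M v "neg_xi \<xi>"] rank_neg_xi_le[OF r(3)] r(1) modal fin
      by (simp add: seq_rank_insert del: rank.simps)
  qed
  ultimately show ?thesis using modal by blast
qed

section \<open>Fischer-Ladner closure\<close>

text \<open>\<open>fl_box \<alpha> \<psi>\<close> collects what arises from
  \<open>Box \<alpha> \<psi>\<close> by working on \<alpha>, leaving out the closure of \<psi>. This
  keeps the recursion structural in \<alpha>: in the star case the new continuation is the starred
  box itself, whose closure would lead back to the same call.\<close>

fun fl :: "('p, 'a) fml \<Rightarrow> ('p, 'a) fml set"
  and fl_box :: "('p, 'a) prog \<Rightarrow> ('p, 'a) fml \<Rightarrow> ('p, 'a) fml set" where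
  "fl Bot = {Bot}"
| "fl (Prop p) = {Prop p}"
| "fl (Neg \<phi>) = insert (Neg \<phi>) (fl \<phi>)"
| "fl (Conj \<phi> \<psi>) = insert (Conj \<phi> \<psi>) (fl \<phi> \<union> fl \<psi>)"
| "fl (Box \<alpha> \<psi>) = fl_box \<alpha> \<psi> \<union> fl \<psi>"
| "fl_box (Atom a) \<psi> = {Box (Atom a) \<psi>}"
| "fl_box (Test \<tau>) \<psi> = insert (Box (Test \<tau>) \<psi>) (fl \<tau>)"
| "fl_box (Choice \<alpha> \<beta>) \<psi> = insert (Box (Choice \<alpha> \<beta>) \<psi>) (fl_box \<alpha> \<psi> \<union> fl_box \<beta> \<psi>)"
| "fl_box (Seq \<alpha> \<beta>) \<psi> = insert (Box (Seq \<alpha> \<beta>) \<psi>) (fl_box \<alpha> (Box \<beta> \<psi>) \<union> fl_box \<beta> \<psi>)"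
| "fl_box (Star \<alpha>) \<psi> = insert (Box (Star \<alpha>) \<psi>) (fl_box \<alpha> (Box (Star \<alpha>) \<psi>))"

lemma finite_fl:
  fixes \<phi> :: "('p, 'a) fml" and \<alpha> :: "('p, 'a) prog"
  shows "finite (fl \<phi>)" and "finite (fl_box \<alpha> \<psi>)"
proof -
  have "finite (fl \<phi>)" and "\<forall>\<psi>. finite (fl_box \<alpha> \<psi>)"
    by (induction \<phi> and \<alpha>) auto
  then show "finite (fl \<phi>)" "finite (fl_box \<alpha> \<psi>)" by auto
qed

lemma Box_in_fl_box: "Box \<alpha> \<psi> \<in> fl_box \<alpha> \<psi>"
  by (cases \<alpha>) auto

lemma self_in_fl: "\<phi> \<in> fl \<phi>"
  by (cases \<phi>) (auto simp: Box_in_fl_box)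

text \<open>Simultaneous induction on formulas and programs. The program half needs every
  continuation \<psi>, since sequence and star change it, and \<open>fl \<psi>\<close> on the right,
  since \<open>fl_box\<close> omits it.\<close>

lemma fl_trans: "\<chi> \<in> fl \<phi> \<Longrightarrow> fl \<chi> \<subseteq> fl \<phi>"
proof -
  have "\<forall>\<chi>\<in>fl \<phi>. fl \<chi> \<subseteq> fl \<phi>"
    and "\<forall>\<psi>. \<forall>\<chi>\<in>fl_box \<alpha> \<psi>. fl \<chi> \<subseteq> fl_box \<alpha> \<psi> \<union> fl \<psi>" for \<alpha> :: "('a, 'b) prog"
  proof (induction \<phi> and \<alpha>)
    case (Seq \<alpha> \<beta>)
    show ?case
    proof (intro allI ballI)
      fix \<psi> \<chi>
      assume "\<chi> \<in> fl_box (Seq \<alpha> \<beta>) \<psi>"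
      then consider "\<chi> = Box (Seq \<alpha> \<beta>) \<psi>" | "\<chi> \<in> fl_box \<alpha> (Box \<beta> \<psi>)" | "\<chi> \<in> fl_box \<beta> \<psi>"
        by auto
      then show "fl \<chi> \<subseteq> fl_box (Seq \<alpha> \<beta>) \<psi> \<union> fl \<psi>"
      proof cases
        case 2
        with Seq(1) have "fl \<chi> \<subseteq> fl_box \<alpha> (Box \<beta> \<psi>) \<union> fl (Box \<beta> \<psi>)" by blast
        then show ?thesis by auto
      next
        case 3
        with Seq(2) have "fl \<chi> \<subseteq> fl_box \<beta> \<psi> \<union> fl \<psi>" by blast
        then show ?thesis by auto
      qed simp
    qed
  next
    case (Star \<alpha>)
    show ?case
    proof (intro allI ballI)
      fix \<psi> \<chi>
      assume "\<chi> \<in> fl_box (Star \<alpha>) \<psi>"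
      then consider "\<chi> = Box (Star \<alpha>) \<psi>" | "\<chi> \<in> fl_box \<alpha> (Box (Star \<alpha>) \<psi>)"
        by auto
      then show "fl \<chi> \<subseteq> fl_box (Star \<alpha>) \<psi> \<union> fl \<psi>"
      proof cases
        case 2
        with Star have "fl \<chi> \<subseteq> fl_box \<alpha> (Box (Star \<alpha>) \<psi>) \<union> fl (Box (Star \<alpha>) \<psi>)" by blast
        then show ?thesis by auto
      qed simp
    qed
  next
    case (Box \<alpha> \<psi>)
    then show ?case unfolding fl.simps by blast
  next
    case (Choice \<alpha> \<beta>)
    then show ?case by (auto; blast)
  qed auto
  then show "\<chi> \<in> fl \<phi> \<Longrightarrow> fl \<chi> \<subseteq> fl \<phi>" by blast
qed

section \<open>Unfoldings and rules stay within the closure\<close>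

lemma Tests_subset_fl_box: "Tests \<alpha> \<subseteq> fl_box \<alpha> \<psi>"
proof (induction \<alpha> arbitrary: \<psi> rule: prog.induct[of "\<lambda>_. True"])
  case (Test \<tau>)
  then show ?case by (simp add: self_in_fl)
next
  case (Choice \<alpha> \<beta>)
  from Choice[of \<psi>] show ?case by auto
next
  case (Seq \<alpha> \<beta>)
  from Seq(1)[of "Box \<beta> \<psi>"] Seq(2)[of \<psi>] show ?case by auto
next
  case (Star \<alpha>)
  from Star[of "Box (Star \<alpha>) \<psi>"] show ?case by auto
qed simp_all

lemma boxes_snoc: "boxes (\<delta>s @ [\<beta>]) \<psi> = boxes \<delta>s (Box \<beta> \<psi>)"
  by (simp add: boxes_def)

lemma boxes_Nil: "boxes [] \<psi> = \<psi>"
  by (simp add: boxes_def)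

text \<open>A program appended to the list becomes a box of the continuation, exactly as in the
  recursion of \<open>fl_box\<close>. The additional element \<psi> accounts for the empty
  list.\<close>

lemma Pset_in_fl_box: "\<delta>s \<in> Pset l \<alpha> \<Longrightarrow> boxes \<delta>s \<psi> \<in> insert \<psi> (fl_box \<alpha> \<psi>)"
proof (induction \<alpha> arbitrary: \<delta>s \<psi> rule: prog.induct[of "\<lambda>_. True"])
  case (Atom a)
  then show ?case by (simp add: boxes_def)
next
  case (Test \<tau>)
  then show ?case by (simp add: boxes_def split: if_splits)
next
  case (Seq \<alpha> \<beta>)
  from Seq.prems consider \<epsilon>s where "\<delta>s = \<epsilon>s @ [\<beta>]" "\<epsilon>s \<in> Pset l \<alpha>" | "\<delta>s \<in> Pset l \<beta>"
    by auto
  then show ?case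
  proof cases
    case 1
    with Seq.IH(1) have "boxes \<delta>s \<psi> \<in> insert (Box \<beta> \<psi>) (fl_box \<alpha> (Box \<beta> \<psi>))"
      by (simp only: boxes_snoc)
    then show ?thesis using Box_in_fl_box[of \<beta> \<psi>] by auto
  next
    case 2
    from Seq.IH(2)[OF this, of \<psi>] show ?thesis by auto
  qed
next
  case (Star \<alpha>)
  from Star.prems consider "\<delta>s = []" | \<epsilon>s where "\<delta>s = \<epsilon>s @ [Star \<alpha>]" "\<epsilon>s \<in> Pset l \<alpha>"
    by auto
  then show ?case
  proof cases
    case 1
    then show ?thesis by (simp add: boxes_Nil)
  next
    case 2
    with Star.IH have "boxes \<delta>s \<psi> \<in> insert (Box (Star \<alpha>) \<psi>) (fl_box \<alpha> (Box (Star \<alpha>) \<psi>))"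
      by (simp only: boxes_snoc)
    then show ?thesis by auto
  qed
qed auto

lemma Hset_in_fl_box: "(Y, \<delta>s) \<in> Hset \<alpha> \<Longrightarrow> boxes \<delta>s \<psi> \<in> insert \<psi> (fl_box \<alpha> \<psi>)"
proof (induction \<alpha> arbitrary: Y \<delta>s \<psi> rule: prog.induct[of "\<lambda>_. True"])
  case (Atom a)
  then show ?case by (simp add: boxes_def)
next
  case (Test \<tau>)
  then show ?case by (simp add: boxes_def)
next
  case (Choice \<alpha> \<beta>)
  then show ?case by (simp, blast)
next
  case (Seq \<alpha> \<beta>)
  from Seq.prems consider \<epsilon>s where "\<delta>s = \<epsilon>s @ [\<beta>]" "(Y, \<epsilon>s) \<in> Hset \<alpha>" | Z where "(Z, \<delta>s) \<in> Hset \<beta>"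
    by auto
  then show ?case
  proof cases
    case 1
    with Seq.IH(1) have "boxes \<delta>s \<psi> \<in> insert (Box \<beta> \<psi>) (fl_box \<alpha> (Box \<beta> \<psi>))"
      by (simp only: boxes_snoc)
    then show ?thesis using Box_in_fl_box[of \<beta> \<psi>] by auto
  next
    case 2
    from Seq.IH(2)[OF this, of \<psi>] show ?thesis by auto
  qed
next
  case (Star \<alpha>)
  from Star.prems consider "\<delta>s = []" | \<epsilon>s where "\<delta>s = \<epsilon>s @ [Star \<alpha>]" "(Y, \<epsilon>s) \<in> Hset \<alpha>"
    by auto
  then show ?case
  proof cases
    case 1
    then show ?thesis by (simp add: boxes_Nil)
  next
    case 2
    with Star.IH have "boxes \<delta>s \<psi> \<in> insert (Box (Star \<alpha>) \<psi>) (fl_box \<alpha> (Box (Star \<alpha>) \<psi>))"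
      by (simp only: boxes_snoc)
    then show ?thesis by auto
  qed
qed simp_all

definition fl_closed :: "('p, 'a) fml set \<Rightarrow> bool" where
  "fl_closed C \<longleftrightarrow> (\<forall>\<phi>\<in>C. fl \<phi> \<subseteq> C)"

text \<open>Unfoldings negate tests and box formulas, so one negation on top of the closed set is
  allowed. Marks are erased here; their number of variants is bounded separately.\<close>

definition within :: "('p, 'a) fml set \<Rightarrow> ('p, 'a) sequent \<Rightarrow> bool" where
  "within C \<Gamma> \<longleftrightarrow> unmark ` \<Gamma> \<subseteq> C \<union> Neg ` C"

lemma within_insert: "within C (insert x \<Delta>) \<longleftrightarrow> unmark x \<in> C \<union> Neg ` C \<and> within C \<Delta>"
  by (auto simp: within_def)

lemma within_Un: "within C (\<Gamma> \<union> \<Delta>) \<longleftrightarrow> within C \<Gamma> \<and> within C \<Delta>"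
  by (auto simp: within_def)

lemma within_Fml_image: "within C (Fml ` G) \<longleftrightarrow> G \<subseteq> C \<union> Neg ` C"
  by (simp add: within_def image_image)

lemma fl_closedD:
  assumes "fl_closed C"
  shows "Neg \<phi> \<in> C \<Longrightarrow> \<phi> \<in> C" and "Conj \<phi> \<psi> \<in> C \<Longrightarrow> \<phi> \<in> C" and "Conj \<phi> \<psi> \<in> C \<Longrightarrow> \<psi> \<in> C"
    and "Box \<alpha> \<psi> \<in> C \<Longrightarrow> \<psi> \<in> C" and "Box \<alpha> \<psi> \<in> C \<Longrightarrow> fl_box \<alpha> \<psi> \<subseteq> C"
  using assms self_in_fl unfolding fl_closed_def by fastforce+

lemma within_rule_inst:
  assumes "rule_inst r \<Gamma> \<C>" "fl_closed C" "within C \<Gamma>" "\<Gamma>' \<in> \<C>"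
  shows "within C \<Gamma>'"
proof -
  note D = fl_closedD[OF assms(2)]
  have NegD: "\<phi> \<in> C" if "Neg \<phi> \<in> C \<union> Neg ` C" for \<phi> using that D(1) by auto
  from assms(1) show ?thesis
  proof cases
    case (neg \<phi> \<Delta>)
    with assms(3,4) NegD[of "Neg \<phi>"] D(1) show ?thesis by (auto simp: within_insert)
  next
    case (conj \<phi> \<psi> \<Delta>)
    with assms(3,4) D(2,3)[of \<phi> \<psi>] show ?thesis by (auto simp: within_insert)
  next
    case (neg_conj \<phi> \<psi> \<Delta>)
    with assms(3,4) NegD[of "Conj \<phi> \<psi>"] D(2,3)[of \<phi> \<psi>] show ?thesis by (auto simp: within_insert)
  next
    case (box \<alpha> \<psi> \<Delta>)
    from box assms(4) obtain G where G: "\<Gamma>' = \<Delta> \<union> Fml ` G" "G \<in> unfold_box \<alpha> \<psi>" by auto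
    from box assms(3) have B: "Box \<alpha> \<psi> \<in> C" "within C \<Delta>" by (auto simp: within_insert)
    have "Tests \<alpha> \<subseteq> C" using Tests_subset_fl_box[of \<alpha> \<psi>] D(5)[OF B(1)] by blast
    moreover have "boxes \<delta>s \<psi> \<in> C" if "\<delta>s \<in> Pset l \<alpha>" for \<delta>s l
      using Pset_in_fl_box[OF that, of \<psi>] D(4,5)[OF B(1)] by auto
    ultimately have "G \<subseteq> C \<union> Neg ` C"
      using G(2) by (auto simp: unfold_box_def Xset_def Fset_def)
    with G B show ?thesis by (simp add: within_Un within_Fml_image)
  next
    case (dia \<alpha> \<psi> \<Delta>)
    from dia assms(4) obtain Y \<delta>s where
      G: "\<Gamma>' = \<Delta> \<union> Fml ` (Y \<union> {Neg (boxes \<delta>s \<psi>)})" "(Y, \<delta>s) \<in> Hset \<alpha>"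
      by (auto simp: unfold_dia_def)
    from dia assms(3) NegD[of "Box \<alpha> \<psi>"] have B: "Box \<alpha> \<psi> \<in> C" "within C \<Delta>" by (auto simp: within_insert)
    have "Y \<subseteq> C" using Hset_Tests[OF G(2)] Tests_subset_fl_box[of \<alpha> \<psi>] D(5)[OF B(1)] by blast
    moreover have "boxes \<delta>s \<psi> \<in> C" using Hset_in_fl_box[OF G(2), of \<psi>] D(4,5)[OF B(1)] by auto
    ultimately show ?thesis using B unfolding G within_Un within_Fml_image by blast
  next
    case (ldia \<alpha> \<xi> \<Delta>)
    from ldia assms(4) obtain Y \<delta>s where
      G: "\<Gamma>' = \<Delta> \<union> (Fml ` Y \<union> {neg_xi (lboxes \<delta>s \<xi>)})" "(Y, \<delta>s) \<in> Hset \<alpha>"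
      by (auto simp: unfold_ldia_def)
    let ?\<psi> = "unmark_xi \<xi>"
    from ldia assms(3) NegD[of "Box \<alpha> ?\<psi>"] have B: "Box \<alpha> ?\<psi> \<in> C" "within C \<Delta>" by (auto simp: within_insert)
    have "Y \<subseteq> C" using Hset_Tests[OF G(2)] Tests_subset_fl_box[of \<alpha> ?\<psi>] D(5)[OF B(1)] by blast
    moreover have "boxes \<delta>s ?\<psi> \<in> C" using Hset_in_fl_box[OF G(2), of ?\<psi>] D(4,5)[OF B(1)] by auto
    ultimately show ?thesis using B unfolding G
      by (auto simp: within_def unmark_neg_xi unmark_lboxes)
  next
    case (lplus a \<alpha>s \<phi> \<Delta>)
    with assms(3,4) show ?thesis by (auto simp: within_insert unmark_neg_xi unmark_lboxes)
  next
    case (lminus \<alpha>s \<phi> \<Delta>)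
    with assms(3,4) show ?thesis by (auto simp: within_insert unmark_neg_xi unmark_lboxes)
  next
    case (modal a \<xi> \<Delta>)
    from modal assms(3) NegD[of "Box (Atom a) (unmark_xi \<xi>)"] D(4)[of "Atom a"]
    have "unmark_xi \<xi> \<in> C" "within C \<Delta>"
      by (auto simp: within_insert)
    moreover from \<open>within C \<Delta>\<close> have "within C (proj a \<Delta>)"
      using D(4) by (force simp: within_def proj_def)
    ultimately show ?thesis using modal assms(4) by (simp add: within_insert unmark_neg_xi)
  qed
qed

text \<open>A formula with \<open>k\<close> leading boxes has only \<open>k + 1\<close> marked
  versions, one for each initial block of boxes that may be marked.\<close>

lemma finite_unmark_xi_vimage: "finite {\<xi>. unmark_xi \<xi> = \<phi>}"
proof (induction "size \<phi>" arbitrary: \<phi> rule: less_induct)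
  case less
  have "\<xi> \<in> insert (Plain \<phi>) (\<Union>(\<alpha>, \<psi>)\<in>{(\<alpha>, \<psi>). \<phi> = Box \<alpha> \<psi>}. LBox \<alpha> ` {\<xi>. unmark_xi \<xi> = \<psi>})"
    if "unmark_xi \<xi> = \<phi>" for \<xi>
    using that by (cases \<xi>) auto
  then have "{\<xi>. unmark_xi \<xi> = \<phi>} \<subseteq>
      insert (Plain \<phi>) (\<Union>(\<alpha>, \<psi>)\<in>{(\<alpha>, \<psi>). \<phi> = Box \<alpha> \<psi>}. LBox \<alpha> ` {\<xi>. unmark_xi \<xi> = \<psi>})"
    by blast
  \<comment> \<open>There is at most one such pair. The \<open>case\<close> is unspecified when
    \<phi> is not a box, but then the set on the left is empty.\<close>
  moreover have "finite {(\<alpha>, \<psi>). \<phi> = Box \<alpha> \<psi>}"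
    by (rule finite_subset[where B = "{case \<phi> of Box \<alpha> \<psi> \<Rightarrow> (\<alpha>, \<psi>)}"]) auto
  ultimately show ?case
    by (elim finite_subset) (auto intro!: less)
qed

lemma finite_unmark_vimage: "finite {x. unmark x = \<phi>}"
proof -
  have "x \<in> insert (Fml \<phi>) (neg_xi ` (\<Union>\<psi>\<in>{\<psi>. \<phi> = Neg \<psi>}. {\<xi>. unmark_xi \<xi> = \<psi>}))"
    if "unmark x = \<phi>" for x
  proof (cases x)
    case (NegLBox \<alpha> \<xi>)
    with that have "x = neg_xi (LBox \<alpha> \<xi>)" "\<phi> = Neg (unmark_xi (LBox \<alpha> \<xi>))" by auto
    then show ?thesis by blast
  qed (use that in auto)
  moreover have "finite {\<psi>. \<phi> = Neg \<psi>}"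
    by (rule finite_subset[where B = "{case \<phi> of Neg \<psi> \<Rightarrow> \<psi>}"]) auto
  ultimately show ?thesis
    by (intro finite_subset[where A = "{x. unmark x = \<phi>}"
        and B = "insert (Fml \<phi>) (neg_xi ` (\<Union>\<psi>\<in>{\<psi>. \<phi> = Neg \<psi>}. {\<xi>. unmark_xi \<xi> = \<psi>}))"])
      (auto simp: finite_unmark_xi_vimage)
qed

lemma finite_within:
  assumes "finite C"
  shows "finite {\<Gamma>. within C \<Gamma>}"
proof -
  have "{\<Gamma>. within C \<Gamma>} \<subseteq> Pow (\<Union>\<phi>\<in>C \<union> Neg ` C. {x. unmark x = \<phi>})"
    by (auto simp: within_def)
  then show ?thesis by (rule finite_subset) (use assms in \<open>simp add: finite_unmark_vimage\<close>)
qed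

section \<open>Tableaux\<close>

lemma nodes_prefix_closed:
  assumes "is_tableau T" "t \<in> nodes T" "prefix s t"
  shows "s \<in> nodes T"
proof -
  have "s @ u \<in> nodes T \<Longrightarrow> s \<in> nodes T" for u
  proof (induction u rule: rev_induct)
    case (snoc i u)
    then have "(s @ u) @ [i] \<in> nodes T" by simp
    with assms(1) have "s @ u \<in> nodes T" unfolding is_tableau_def by blast
    then show ?case by (rule snoc.IH)
  qed simp
  with assms show ?thesis by (auto simp: prefix_def)
qed

lemma strict_prefix_not_leaf:
  assumes "is_tableau T" "t \<in> nodes T" "strict_prefix s t"
  shows "\<not> leaf T s"
proof -
  from assms(3) obtain i u where "t = (s @ [i]) @ u" by (auto elim: strict_prefixE')
  with nodes_prefix_closed[OF assms(1,2), of "s @ [i]"] show ?thesis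
    by (auto simp: leaf_def children_def)
qed

text \<open>Every label stays within the Fischer-Ladner closure of the finite root label, by
  induction along the branch. The tree itself may still be infinite.\<close>

lemma finitely_many_labels:
  assumes "is_tableau T"
  shows "finite (label T ` nodes T)"
proof -
  define C where "C = (\<Union>x\<in>label T []. fl (unmark x))"
  have "finite C" using assms by (auto simp: C_def is_tableau_def finite_fl)
  have "fl_closed C" using fl_trans by (fastforce simp: C_def fl_closed_def)
  have "within C (label T t)" if "t \<in> nodes T" for t
    using that
  proof (induction t rule: rev_induct)
    case Nil
    show ?case using self_in_fl by (auto simp: within_def C_def)
  next
    case (snoc i t)
    with nodes_prefix_closed[OF assms, of "t @ [i]" t] have t: "t \<in> nodes T" by simp
    have "t @ [i] \<in> children T t" using snoc.prems by (auto simp: children_def)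
    moreover from this t have "interior T t" by (auto simp: interior_def)
    then have "rule_inst (rule_at T t) (label T t) (label T ` children T t)"
      using assms by (simp add: is_tableau_def)
    ultimately show ?case
      using within_rule_inst \<open>fl_closed C\<close> snoc.IH[OF t] by blast
  qed
  then show ?thesis
    by (intro finite_subset[OF _ finite_within[OF \<open>finite C\<close>]]) auto
qed

lemma tableau_step:
  assumes "is_tableau T" "t \<in> nodes T" "\<not> leaf T t" "sat_sequent M w (label T t)"
  shows "\<exists>s v. s \<in> nodes T \<and> (\<exists>i. s = t @ [i]) \<and> sat_sequent M v (label T s) \<and>
    (loaded (label T t) \<longrightarrow> seq_rank M v (label T s) < seq_rank M w (label T t) \<or>
       seq_rank M v (label T s) \<le> seq_rank M w (label T t) \<and>
       seq_wt (label T s) < seq_wt (label T t))"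
proof -
  from assms have "interior T t" by (simp add: interior_def leaf_def)
  with assms have "rule_inst (rule_at T t) (label T t) (label T ` children T t)"
    "finite (label T t)" "\<forall>s\<in>children T t. finite (label T s)"
    by (auto simp: is_tableau_def children_def)
  from rule_inst_step[OF this(1,2) _ assms(4)] this(3) obtain s v where "s \<in> children T t" "sat_sequent M v (label T s)"
    "loaded (label T t) \<longrightarrow> seq_rank M v (label T s) < seq_rank M w (label T t) \<or>
       seq_rank M v (label T s) \<le> seq_rank M w (label T t) \<and>
       seq_wt (label T s) < seq_wt (label T t)"
    by (simp add: Ball_def) blast
  then show ?thesis by (intro exI[of _ s] exI[of _ v]) (auto simp: children_def)
qed

section \<open>Descent among satisfied nodes\<close>

lemma closed_sequent_unsat: "closed_sequent \<Gamma> \<Longrightarrow> \<not> sat_sequent M w \<Gamma>"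
  unfolding closed_sequent_def sat_sequent_def
  by (metis sat.simps(1) sat.simps(3) unmark.simps(1))

text \<open>\<open>S\<close> is kept abstract because two sets are substituted for it later: the
  satisfied nodes below a deepest satisfied free node, and all satisfied nodes if none of them is
  free.\<close>

lemma no_satisfied_loaded_part:
  fixes M :: "('w, 'p, 'a) kripke"
  assumes T: "closed_pdl_tableau T"
    and S: "\<And>s. s \<in> S \<Longrightarrow> s \<in> nodes T \<and> loaded (label T s) \<and> (\<exists>w. sat_sequent M w (label T s))"
    and child: "\<And>s i w. s \<in> S \<Longrightarrow> s @ [i] \<in> nodes T \<Longrightarrow> sat_sequent M w (label T (s @ [i])) \<Longrightarrow>
      s @ [i] \<in> S"
    and comp: "\<And>c s. s \<in> S \<Longrightarrow> companion T c s \<Longrightarrow>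
      \<forall>r. prefix c r \<and> prefix r s \<longrightarrow> loaded (label T r) \<Longrightarrow> c \<in> S"
  shows "S = {}"
proof (rule ccontr)
  assume "S \<noteq> {}"
  have tab: "is_tableau T" using T by (simp add: closed_pdl_tableau_def pdl_tableau_def)
  define Q where "Q s w \<longleftrightarrow> s \<in> S \<and> sat_sequent M w (label T s)" for s w
  define m where "m = (LEAST n. \<exists>s w. Q s w \<and> seq_rank M w (label T s) = n)"
  have ex: "\<exists>n s w. Q s w \<and> seq_rank M w (label T s) = n" using \<open>S \<noteq> {}\<close> S by (auto simp: Q_def)
  then have ex_m: "\<exists>s w. Q s w \<and> seq_rank M w (label T s) = m"
    unfolding m_def by (rule LeastI_ex)
  have m_le: "m \<le> seq_rank M w (label T s)" if "Q s w" for s w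
    unfolding m_def by (rule Least_le) (use that in blast)
  define P where "P s \<longleftrightarrow> (\<exists>w. Q s w \<and> seq_rank M w (label T s) = m)" for s
  \<comment> \<open>Least depth among the nodes that attain \<open>m\<close> ensures that no
    companion attaining \<open>m\<close> lies strictly above \<open>s\<close>.\<close>
  obtain s where s: "P s" "\<And>r. P r \<Longrightarrow> length s \<le> length r"
    using ex_m exists_least_iff[of "\<lambda>n. \<exists>s. P s \<and> length s = n"]
    by (metis P_def not_le)
  \<comment> \<open>These nodes lie below \<open>s\<close>, attain \<open>m\<close>, and weigh less
    than every earlier node on the path from \<open>s\<close>. Taking one of least weight stands in
    for following a branch downwards until it stops.\<close>
  define N where "N u \<longleftrightarrow> P u \<and> prefix s u \<and>
    (\<forall>x. prefix s x \<and> strict_prefix x u \<longrightarrow> seq_wt (label T u) < seq_wt (label T x))" for u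
  have "N s" using s by (auto simp: N_def dest: prefix_order.antisym)
  then obtain u where u: "N u" "\<And>r. N r \<Longrightarrow> seq_wt (label T u) \<le> seq_wt (label T r)"
    using exists_least_iff[of "\<lambda>n. \<exists>s. N s \<and> seq_wt (label T s) = n"] by (metis not_le)
  then obtain w where w: "Q u w" "seq_rank M w (label T u) = m" by (auto simp: N_def P_def)
  then have uS: "u \<in> S" "u \<in> nodes T" "loaded (label T u)" "sat_sequent M w (label T u)"
    using S by (auto simp: Q_def)
  show False
  proof (cases "leaf T u")
    case True
    with T closed_sequent_unsat[of "label T u" M w] uS have "loaded_path_repeat T u"
      by (auto simp: closed_pdl_tableau_def)
    then obtain c where c: "companion T c u"
      "\<forall>r. prefix c r \<and> prefix r u \<longrightarrow> loaded (label T r)"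
      by (auto simp: loaded_path_repeat_def)
    then have "c \<in> S" using comp uS by blast
    moreover have cu: "label T c = label T u" "strict_prefix c u" using c by (auto simp: companion_def)
    \<comment> \<open>The labels agree, so the same state \<open>w\<close> gives \<open>c\<close>
      the rank \<open>m\<close>.\<close>
    ultimately have "P c" using w by (auto simp: P_def Q_def)
    then have "length s \<le> length c" by (rule s)
    moreover have "prefix s u" using u by (simp add: N_def)
    ultimately have "prefix s c"
      using cu(2) prefix_length_prefix[of s u c] by (auto simp: strict_prefix_def)
    \<comment> \<open>Now \<open>c\<close> lies between \<open>s\<close> and \<open>u\<close>,
      strictly above \<open>u\<close>, so \<open>N u\<close> makes it heavier than \<open>u\<close>
      although the labels are equal.\<close>
    with u cu show False unfolding N_def by (metis less_irrefl)
  next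
    case False
    from tableau_step[OF tab uS(2) False uS(4)] uS(3) obtain i v where
      v: "u @ [i] \<in> nodes T" "sat_sequent M v (label T (u @ [i]))"
      "seq_rank M v (label T (u @ [i])) < m \<or>
       seq_rank M v (label T (u @ [i])) \<le> m \<and> seq_wt (label T (u @ [i])) < seq_wt (label T u)"
      unfolding w(2) by blast
    have "Q (u @ [i]) v" using v child uS by (auto simp: Q_def)
    \<comment> \<open>The child belongs to \<open>S\<close>, so its rank cannot fall below
      \<open>m\<close>; only the alternative with decreasing weight remains.\<close>
    with m_le[OF this] v have less: "seq_wt (label T (u @ [i])) < seq_wt (label T u)"
      and "P (u @ [i])" by (auto simp: P_def)
    then have "N (u @ [i])"
      using u(1) unfolding N_def strict_prefix_def
      by (metis less_trans prefix_snoc prefix_order.order_refl prefix_order.trans prefixI)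
    with u(2) less show False by (meson not_le)
  qed
qed

text \<open>The free proper ancestors of a node have distinct labels: otherwise the lower one would
  be a free repeat, hence a leaf, yet it has a descendant. As there are finitely many labels, their
  number is bounded, and a node with the most free proper ancestors is as required.\<close>

lemma exists_deepest_free:
  assumes T: "pdl_tableau T" and t: "t \<in> nodes T" "free (label T t)" "R t"
  shows "\<exists>t\<in>nodes T. free (label T t) \<and> R t \<and>
    (\<forall>s\<in>nodes T. strict_prefix t s \<and> R s \<longrightarrow> loaded (label T s))"
proof -
  have tab: "is_tableau T" using T by (simp add: pdl_tableau_def)
  define P where "P t = {s. strict_prefix s t \<and> free (label T s)}" for t
  have fin: "finite (P t)" for t
    by (rule finite_subset[of _ "set (prefixes t)"]) (auto simp: P_def strict_prefix_def in_set_prefixes)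
  have inj: "inj_on (label T) (P t)" if "t \<in> nodes T" for t
  proof -
    have False if s: "s \<in> P t" "s' \<in> P t" "label T s = label T s'" "strict_prefix s s'" for s s'
    proof -
      have "s' \<in> nodes T"
        using s nodes_prefix_closed[OF tab \<open>t \<in> nodes T\<close>] by (auto simp: P_def strict_prefix_def)
      with s have "free_repeat T s'" by (auto simp: free_repeat_def repeat_def P_def)
      then have "leaf T s'" using T by (simp add: pdl_tableau_def)
      with strict_prefix_not_leaf[OF tab \<open>t \<in> nodes T\<close>] s show False by (auto simp: P_def)
    qed
    moreover have "s = s' \<or> strict_prefix s s' \<or> strict_prefix s' s" if "s \<in> P t" "s' \<in> P t" for s s'
      using that prefix_same_cases[of s t s'] by (auto simp: P_def strict_prefix_def)
    ultimately show ?thesis unfolding inj_on_def by metis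
  qed
  have bound: "card (P t) \<le> card (label T ` nodes T)" if "t \<in> nodes T" for t
  proof -
    have "label T ` P t \<subseteq> label T ` nodes T"
      using nodes_prefix_closed[OF tab that] by (auto simp: P_def strict_prefix_def)
    with card_mono[OF finitely_many_labels[OF tab]] card_image[OF inj[OF that]] show ?thesis
      by metis
  qed
  define G where "G t \<longleftrightarrow> t \<in> nodes T \<and> free (label T t) \<and> R t" for t
  obtain t' where t': "G t'" "\<And>s. G s \<Longrightarrow> card (P s) \<le> card (P t')"
    using ex_has_greatest_nat[of G t "\<lambda>t. card (P t)" "Suc (card (label T ` nodes T))"] t bound
    by (auto simp: G_def le_imp_less_Suc)
  have "loaded (label T s)" if s: "s \<in> nodes T" "strict_prefix t' s" "R s" for s
  proof (rule ccontr)
    assume "free (label T s)"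
    with s have "G s" by (simp add: G_def)
    \<comment> \<open>A free node below \<open>t'\<close> would have \<open>t'\<close> as an
      additional free proper ancestor.\<close>
    have "insert t' (P t') \<subseteq> P s" using s t' by (auto simp: P_def G_def)
    moreover have "t' \<notin> P t'" by (simp add: P_def)
    ultimately have "card (P t') < card (P s)"
      using card_mono[OF fin[of s], of "insert t' (P t')"] fin[of t'] by simp
    with t'(2)[OF \<open>G s\<close>] show False by simp
  qed
  with t' show ?thesis by (auto simp: G_def)
qed

theorem theorem5p1:
  fixes T :: "('p, 'a) tableau" and t :: "nat list"
  assumes "closed_pdl_tableau T"
    and "t \<in> nodes T"
  shows "\<not> (\<exists>(M :: ('w, 'p, 'a) kripke) w. sat_sequent M w (label T t))"
proof
  assume "\<exists>(M :: ('w, 'p, 'a) kripke) w. sat_sequent M w (label T t)"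
  then obtain M :: "('w, 'p, 'a) kripke" and w where w: "sat_sequent M w (label T t)" by blast
  have pdl: "pdl_tableau T" using assms(1) by (simp add: closed_pdl_tableau_def)
  then have tab: "is_tableau T" by (simp add: pdl_tableau_def)
  define R where "R s \<longleftrightarrow> (\<exists>w. sat_sequent M w (label T s))" for s
  show False
  proof (cases "\<exists>s\<in>nodes T. free (label T s) \<and> R s")
    case True
    with exists_deepest_free[OF pdl, of _ R] obtain r where r: "r \<in> nodes T" "free (label T r)" "R r"
      "\<forall>s\<in>nodes T. strict_prefix r s \<and> R s \<longrightarrow> loaded (label T s)"
      by blast
    define S where "S = {s \<in> nodes T. strict_prefix r s \<and> R s}"
    have "S = {}"
    proof (rule no_satisfied_loaded_part[OF assms(1), of _ M])
      fix c s
      assume c: "s \<in> S" "companion T c s" "\<forall>r. prefix c r \<and> prefix r s \<longrightarrow> loaded (label T r)"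
      then have "prefix c s" "label T c = label T s" by (auto simp: companion_def strict_prefix_def)
      have rs: "prefix r s" using c(1) by (auto simp: S_def strict_prefix_def)
      \<comment> \<open>A companion at or above \<open>r\<close> would put the free node
        \<open>r\<close> on a path of loaded nodes.\<close>
      with c(3) r(2) have "\<not> prefix c r" by blast
      with rs \<open>prefix c s\<close> have "strict_prefix r c"
        using prefix_same_cases[of r s c] by (auto simp: strict_prefix_def)
      with c(1) \<open>prefix c s\<close> \<open>label T c = label T s\<close> nodes_prefix_closed[OF tab] show "c \<in> S"
        by (auto simp: S_def R_def)
    next
      fix s i w
      assume "s \<in> S" "s @ [i] \<in> nodes T" "sat_sequent M w (label T (s @ [i]))"
      then show "s @ [i] \<in> S" by (auto simp: S_def R_def strict_prefix_def prefix_def)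
    qed (use r in \<open>auto simp: S_def R_def\<close>)
    obtain v where v: "sat_sequent M v (label T r)" using r by (auto simp: R_def)
    \<comment> \<open>Being free, \<open>r\<close> could only be a leaf by being closed, which its
      satisfiability excludes. So it has a satisfied child, and this child shows that
      \<open>S\<close> is nonempty.\<close>
    have "\<not> loaded_path_repeat T r"
      using r(2) by (auto simp: loaded_path_repeat_def companion_def strict_prefix_def)
    then have "\<not> leaf T r"
      using assms(1) closed_sequent_unsat[of "label T r" M v] v by (auto simp: closed_pdl_tableau_def)
    from tableau_step[OF tab r(1) this v] obtain i where "r @ [i] \<in> S"
      by (auto simp: S_def R_def strict_prefix_def)
    with \<open>S = {}\<close> show False by blast
  next
    case False
    \<comment> \<open>Here every satisfied node is loaded, so all of them can be taken at once; a
      companion has the same label and is again satisfied.\<close>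
    define S where "S = {s \<in> nodes T. R s}"
    have "S = {}"
    proof (rule no_satisfied_loaded_part[OF assms(1), of _ M])
      fix c s
      assume "s \<in> S" "companion T c s"
      then show "c \<in> S" using nodes_prefix_closed[OF tab, of s c]
        by (auto simp: S_def R_def companion_def strict_prefix_def)
    qed (use False in \<open>auto simp: S_def R_def\<close>)
    with assms(2) w show False by (auto simp: S_def R_def)
  qed
qed

end
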